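(* Let $(b_n)$ be a monotone sequence with $b_n>0$, $\lim_n b_n=\infty$, $\lim_n b_n/b_{n-1}=1$ and $\sum_n 1/b_n=\infty$. Then there exists a weight $w(x)>0$ on the real line $\mathbb R$ such that the orthonormal polynomials $p_n$, $n=0,1,\dots$, with respect to $w(x)\,dx$ form an (orthonormal) basis in $L^2(\mathbb R,w\,dx)$ and $$|p_n(x)|^2\le \frac{C(x)}{b_n}\quad\text{for all }n\text{ and }x\in\mathbb R,$$ where $C(x)>0$ is a locally bounded function on $\mathbb R$.
   Context: The orthonormal polynomials with respect to a measure $\nu$ on $\mathbb R$ are the polynomials $p_n$ of degree $n$ with positive leading coefficient obtained by Gram–Schmidt orthonormalization of $1,x,x^2,\dots$ in $L^2(\nu)$. *)

theory Defs
  imports "HOL-Analysis.Analysis" "HOL-Computational_Algebra.Polynomial"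
begin

text \<open>An admissible weight on the real line: positive, Borel measurable, and all
  moments finite (so that the orthonormal polynomials with respect to w(x)dx exist).\<close>
definition admissible_weight :: "(real \<Rightarrow> real) \<Rightarrow> bool" where
  "admissible_weight w \<longleftrightarrow> (\<forall>x. w x > 0) \<and> w \<in> borel_measurable lborel \<and>
     (\<forall>k::nat. integrable lborel (\<lambda>x. x ^ k * w x))"

text \<open>p is the sequence of orthonormal polynomials w.r.t. w(x)dx: p n has degree n,
  positive leading coefficient, and the family is orthonormal in L^2(w dx).
  (These conditions determine p uniquely, i.e. Gram-Schmidt of 1, x, x^2, ...)\<close>
definition orthonormal_polys :: "(real \<Rightarrow> real) \<Rightarrow> (nat \<Rightarrow> real poly) \<Rightarrow> bool" where
  "orthonormal_polys w p \<longleftrightarrow>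
     (\<forall>n. degree (p n) = n \<and> lead_coeff (p n) > 0) \<and>
     (\<forall>m n. (LINT x|lborel. poly (p m) x * poly (p n) x * w x) = (if m = n then 1 else 0))"

definition L2w :: "(real \<Rightarrow> real) \<Rightarrow> (real \<Rightarrow> real) \<Rightarrow> bool" where
  "L2w w f \<longleftrightarrow> f \<in> borel_measurable lborel \<and> integrable lborel (\<lambda>x. (f x)\<^sup>2 * w x)"

definition is_basis_L2w :: "(real \<Rightarrow> real) \<Rightarrow> (nat \<Rightarrow> real poly) \<Rightarrow> bool" where
  "is_basis_L2w w p \<longleftrightarrow>
     (\<forall>f. L2w w f \<longrightarrow> (\<forall>\<epsilon>>0. \<exists>N (c::nat \<Rightarrow> real).
        (LINT x|lborel. (f x - (\<Sum>n<N. c n * poly (p n) x))\<^sup>2 * w x) < \<epsilon>))"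

definition locally_bounded :: "(real \<Rightarrow> real) \<Rightarrow> bool" where
  "locally_bounded C \<longleftrightarrow> (\<forall>K. compact K \<longrightarrow> bounded (C ` K))"

end

theory Submission
  imports Defs "HOL-Complex_Analysis.Complex_Analysis" "HOL-Probability.Sinc_Integral"
    "HOL-Real_Asymp.Real_Asymp"
begin

text \<open>
  Take the Jacobi matrix with zero diagonal and off-diagonal entries \<open>a (2 k) = b (2 k)\<close> and
  \<open>a (2 k + 1) = sqrt (b (2 k) * b (2 k + 2))\<close>; the geometric means are what makes a merely
  monotone \<open>b\<close> suffice. Indeed the Turan-type forms
  \<open>F k = a (2 k) * (p (2 k)^2 + p (2 k + 1)^2) - x * p (2 k) * p (2 k + 1)\<close> then satisfy
  \<open>\<bar>F (k + 1) - F k\<bar> \<le> C * \<bar>x\<bar> * (1 / a (2 k) - 1 / a (2 k + 2)) * F k\<close>, so they converge locally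
  uniformly to a positive limit \<open>F\<close>, which bounds \<open>b n * (p n x)^2\<close>. The weight is \<open>1 / (pi * F)\<close>:
  it is the limit of the densities \<open>1 / (pi * a n * (p n^2 + p (n + 1)^2))\<close>, for which
  \<open>p 0, ..., p n\<close> are orthonormal because \<open>p (n + 1) + \<i> * p n\<close> has no zeros in the closed upper
  half plane.

  For the basis property, the Christoffel-Darboux kernel at \<open>\<i>\<close> diverges (Carleman), so
  \<open>1 / (x - \<i>)\<close> lies in the closure of the polynomials. That closure is then invariant under
  multiplication by \<open>1 / (1 + x^2)\<close> and \<open>x / (1 + x^2)\<close>, hence by all indicators of Borel sets.
\<close>

section \<open>Integrals of rational functions\<close>

text \<open>The theorem asks only for the size of the polynomials, so the Jacobi coefficients may be
  altered by bounded factors. The obstacle is regularity: monotonicity says nothing about how the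
  differences of \<open>b\<close> vary. Written in the pair \<open>p (2 k + 1)\<close>,
  \<open>p (2 k + 2)\<close>, the form \<open>F k\<close> has diagonal coefficients
  \<open>a (2 k)\<close> and \<open>a (2 k + 1)^2 / a (2 k)\<close>, while \<open>F (k + 1)\<close>
  has \<open>a (2 k + 1)^2 / a (2 k + 2)\<close> and \<open>a (2 k + 2)\<close>. Both pairs agree
  exactly when \<open>a (2 k + 1)\<close> is the geometric mean; what remains is a cross term whose
  coefficient changes by a multiple of \<open>1 / a (2 k) - 1 / a (2 k + 2)\<close>, and these
  differences telescope.

  Jacobi coefficients alone yield some orthogonality measure, not a density. Here the comparison of
  \<open>F k\<close> with a fixed \<open>F k0\<close> bounds the approximating densities on compact
  sets, which excludes concentration in the limit, and their eventually constant moments exclude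
  escape of mass to infinity. Uniqueness of orthonormal polynomials then transfers every claim from
  the recursively defined sequence to an arbitrary one.\<close>

lemma poly_norm_upper:
  fixes p :: "'a::real_normed_field poly"
  shows "\<exists>C\<ge>0. \<forall>z. 1 \<le> norm z \<longrightarrow> norm (poly p z) \<le> C * norm z ^ degree p"
proof (intro exI conjI allI impI)
  show "0 \<le> (\<Sum>i\<le>degree p. norm (coeff p i))" by (simp add: sum_nonneg)
  fix z :: 'a assume z: "1 \<le> norm z"
  have "norm (poly p z) \<le> (\<Sum>i\<le>degree p. norm (coeff p i * z ^ i))"
    unfolding poly_altdef by (rule norm_sum)
  also have "\<dots> \<le> (\<Sum>i\<le>degree p. norm (coeff p i) * norm z ^ degree p)"
    using z by (intro sum_mono) (auto simp: norm_mult norm_power intro!: mult_left_mono power_increasing)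
  also have "\<dots> = (\<Sum>i\<le>degree p. norm (coeff p i)) * norm z ^ degree p"
    by (simp add: sum_distrib_right)
  finally show "norm (poly p z) \<le> (\<Sum>i\<le>degree p. norm (coeff p i)) * norm z ^ degree p" .
qed

lemma poly_norm_lower:
  fixes p :: "'a::real_normed_field poly"
  assumes "p \<noteq> 0"
  shows "\<exists>c>0. \<exists>R. \<forall>z. R \<le> norm z \<longrightarrow> c * norm z ^ degree p \<le> norm (poly p z)"
proof (cases "degree p")
  case 0
  then obtain c where "p = [:c:]" by (metis degree_eq_zeroE)
  then show ?thesis using assms 0 by (intro exI[of _ "norm c"]) auto
next
  case (Suc n)
  define e where "e = norm (lead_coeff p) / 2"
  have e: "e > 0" using assms by (simp add: e_def)
  from polyfun_extremal_lemma[OF e, of "coeff p" n] obtain M where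
    M: "\<And>z. M \<le> norm z \<Longrightarrow> norm (\<Sum>i\<le>n. coeff p i * z ^ i) \<le> e * norm z ^ Suc n" by blast
  have "e * norm z ^ degree p \<le> norm (poly p z)" if "M \<le> norm z" for z
  proof -
    have "poly p z = (\<Sum>i\<le>n. coeff p i * z ^ i) + lead_coeff p * z ^ Suc n"
      unfolding poly_altdef Suc by simp
    then have "norm (lead_coeff p * z ^ Suc n) \<le> norm (poly p z) + norm (\<Sum>i\<le>n. coeff p i * z ^ i)"
      by (metis add_diff_cancel_left' norm_triangle_ineq4)
    then show ?thesis using M[OF that] by (simp add: norm_mult norm_power Suc e_def)
  qed
  then show ?thesis using e by blast
qed

lemma rational_decay:
  fixes p q :: "'a::real_normed_field poly"
  assumes "degree p + 2 \<le> degree q"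
  shows "\<exists>C\<ge>0. \<exists>R\<ge>1. \<forall>z. R \<le> norm z \<longrightarrow> norm (poly p z / poly q z) \<le> C / (norm z)\<^sup>2"
proof -
  have "q \<noteq> 0" using assms by auto
  then obtain c R where c: "c > 0" and R: "\<And>z. R \<le> norm z \<Longrightarrow> c * norm z ^ degree q \<le> norm (poly q z)"
    using poly_norm_lower by blast
  obtain C where C: "C \<ge> 0" "\<And>z::'a. 1 \<le> norm z \<Longrightarrow> norm (poly p z) \<le> C * norm z ^ degree p"
    using poly_norm_upper by blast
  have "norm (poly p z / poly q z) \<le> (C / c) / (norm z)\<^sup>2" if z: "max R 1 \<le> norm z" for z
  proof -
    have z1: "norm z \<ge> 1" using z by simp
    have "norm (poly p z) * (norm z)\<^sup>2 \<le> C * norm z ^ degree p * (norm z)\<^sup>2"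
      using C(2)[OF z1] by (intro mult_right_mono) auto
    also have "\<dots> = C * norm z ^ (degree p + 2)" by (simp add: power_add power2_eq_square)
    also have "\<dots> \<le> C * norm z ^ degree q"
      using C(1) z1 assms by (intro mult_left_mono power_increasing) auto
    also have "\<dots> \<le> C * (norm (poly q z) / c)"
      using R[of z] z c C(1) by (intro mult_left_mono) (auto simp: field_simps)
    finally have 1: "norm (poly p z) * (norm z)\<^sup>2 \<le> C / c * norm (poly q z)" by simp
    have "0 < c * norm z ^ degree q" using c z1 by (auto intro!: mult_pos_pos zero_less_power)
    then have "norm (poly q z) > 0" using R[of z] z by linarith
    moreover have "(norm z)\<^sup>2 > 0" using z1 by (auto intro!: zero_less_power)
    moreover define K where "K = C / c"
    ultimately show ?thesis using 1 unfolding K_def[symmetric] norm_divide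
      by (simp add: pos_divide_le_eq pos_le_divide_eq mult.commute)
  qed
  then show ?thesis using C c by (intro exI[of _ "C/c"] conjI exI[of _ "max R 1"]) auto
qed

lemma integrable_inverse_1_plus_square_lborel:
  "integrable lborel (\<lambda>x::real. 1 / (1 + x\<^sup>2))"
  using integrable_inverse_1_plus_square
  by (simp add: set_integrable_def inverse_eq_divide)

lemma integral_inverse_1_plus_square_lborel:
  "(LINT x|lborel. 1 / (1 + x\<^sup>2 :: real)) = pi"
  using LBINT_inverse_1_plus_square
  by (simp add: interval_lebesgue_integral_def set_lebesgue_integral_def inverse_eq_divide)

lemma integrable_quadratic_decay:
  fixes f :: "real \<Rightarrow> 'b::{banach, second_countable_topology}"
  assumes cont: "continuous_on UNIV f" and C: "C \<ge> 0" and R: "R \<ge> 1"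
    and le: "\<And>x. R \<le> \<bar>x\<bar> \<Longrightarrow> norm (f x) \<le> C / x\<^sup>2"
  shows "integrable lborel f"
proof -
  have "compact (f ` {-R..R})"
    using cont by (intro compact_continuous_image continuous_on_subset[OF cont]) auto
  then have "bounded (f ` {-R..R})" by (rule compact_imp_bounded)
  then obtain B where B: "\<And>x. x \<in> {-R..R} \<Longrightarrow> norm (f x) \<le> B"
    unfolding bounded_iff by blast
  have "norm (f 0) \<le> B" using B[of 0] R by auto
  then have B0: "B \<ge> 0" using norm_ge_zero order_trans by blast
  define K where "K = B * (1 + R\<^sup>2) + 2 * C"
  have bd: "norm (f x) \<le> K * (1 / (1 + x\<^sup>2))" for x
  proof (cases "\<bar>x\<bar> \<le> R")
    case True
    have "norm (f x) * (1 + x\<^sup>2) \<le> B * (1 + R\<^sup>2)"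
      using B[of x] True B0 R by (intro mult_mono) (auto simp: abs_le_iff abs_le_square_iff[symmetric])
    also have "\<dots> \<le> K" using C by (simp add: K_def)
    finally show ?thesis by (simp add: field_simps add_pos_nonneg)
  next
    case False
    have x: "1 \<le> x\<^sup>2" using False R one_le_power[of "\<bar>x\<bar>" 2] by simp
    have "norm (f x) \<le> C / x\<^sup>2" using le[of x] False by simp
    also have "\<dots> \<le> 2 * C * (1 / (1 + x\<^sup>2))"
    proof -
      have "C * (1 + x\<^sup>2) \<le> C * (2 * x\<^sup>2)" using x C by (intro mult_left_mono) auto
      moreover have "x\<^sup>2 > 0" "1 + x\<^sup>2 > 0" using x by linarith+
      ultimately show ?thesis by (simp add: divide_simps mult.commute)
    qed
    also have "\<dots> \<le> K * (1 / (1 + x\<^sup>2))" unfolding K_def using B0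
      by (intro mult_right_mono) auto
    finally show ?thesis .
  qed
  have "integrable lborel (\<lambda>x. K * (1 / (1 + x\<^sup>2)))"
    by (intro integrable_mult_right integrable_inverse_1_plus_square_lborel)
  then show ?thesis
  proof (rule Bochner_Integration.integrable_bound)
    show "f \<in> borel_measurable lborel" using cont borel_measurable_continuous_onI by simp
    show "AE x in lborel. norm (f x) \<le> norm (K * (1 / (1 + x\<^sup>2)))"
      using bd by (intro AE_I2) (metis abs_ge_self dual_order.trans real_norm_def)
  qed
qed

lemma integrable_rational:
  fixes p q :: "'a::{real_normed_field, banach, second_countable_topology} poly"
  assumes deg: "degree p + 2 \<le> degree q" and nz: "\<And>x::real. poly q (of_real x) \<noteq> 0"
  shows "integrable lborel (\<lambda>x::real. poly p (of_real x) / poly q (of_real x))"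
proof -
  obtain C R where "C \<ge> 0" "R \<ge> 1" and
    d: "\<And>z::'a. R \<le> norm z \<Longrightarrow> norm (poly p z / poly q z) \<le> C / (norm z)\<^sup>2"
    using rational_decay[OF deg] by blast
  then show ?thesis
  proof (intro integrable_quadratic_decay)
    show "continuous_on UNIV (\<lambda>x::real. poly p (of_real x) / poly q (of_real x))"
      using nz by (auto intro!: continuous_intros)
    show "norm (poly p (of_real x) / poly q (of_real x)) \<le> C / x\<^sup>2" if "R \<le> \<bar>x\<bar>" for x :: real
      using d[of "of_real x"] that by simp
  qed
qed

text \<open>The contour is closed in the half plane free of poles; the arc contributes nothing in the limit.\<close>
lemma integral_rational_eq_0:
  fixes p q :: "complex poly"
  assumes deg: "degree p + 2 \<le> degree q" and nz: "\<And>z. Im z \<ge> 0 \<Longrightarrow> poly q z \<noteq> 0"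
  shows "(LINT x|lborel. poly p (of_real x) / poly q (of_real x)) = 0"
proof -
  define f where "f = (\<lambda>z. poly p z / poly q z)"
  have int: "integrable lborel (\<lambda>x::real. f (of_real x))"
    unfolding f_def by (rule integrable_rational[OF deg]) (simp add: nz)
  obtain C R where C: "C \<ge> 0" and R: "R \<ge> 1" and
    d: "\<And>z::complex. R \<le> norm z \<Longrightarrow> norm (f z) \<le> C / (norm z)\<^sup>2"
    using rational_decay[OF deg] unfolding f_def by blast
  define I where "I = (\<lambda>r. LINT x:{-r..r}|lborel. f (of_real x))"
  have bd: "norm (I r) \<le> C * pi / r" if r: "r \<ge> R" for r
  proof -
    have r0: "r > 0" using r R by simp
    define H where "H = {z. Im z \<ge> 0}"
    have sub1: "path_image (linepath (-complex_of_real r) (complex_of_real r)) \<subseteq> H"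
      unfolding H_def path_image_linepath by (auto simp: closed_segment_def)
    have sub2: "path_image (part_circlepath 0 r 0 pi) \<subseteq> H"
      unfolding H_def using r0
      by (auto simp: path_image_def part_circlepath_def linepath_def image_iff sin_ge_zero mult_nonneg_nonneg Im_exp)
    let ?g = "linepath (-complex_of_real r) (complex_of_real r) +++ part_circlepath 0 r 0 pi"
    have holo: "f holomorphic_on H" unfolding f_def H_def by (intro holomorphic_intros) (auto simp: nz)
    have "(f has_contour_integral 0) ?g"
    proof (rule Cauchy_theorem_convex_simple)
      show "f holomorphic_on H" by fact
      show "convex H" unfolding H_def by (rule convex_halfspace_Im_ge)
      show "valid_path ?g" by (intro valid_path_join) auto
      show "path_image ?g \<subseteq> H" using sub1 sub2 path_image_join_subset by blast
      show "pathfinish ?g = pathstart ?g" by simp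
    qed
    moreover have ci1: "f contour_integrable_on linepath (-complex_of_real r) (complex_of_real r)"
      using holo sub1 by (intro contour_integrable_continuous_linepath)
        (auto intro: continuous_on_subset holomorphic_on_imp_continuous_on simp: path_image_linepath)
    moreover have ci2: "f contour_integrable_on part_circlepath 0 r 0 pi"
      using holo sub2 by (intro contour_integrable_continuous_part_circlepath)
        (auto intro: continuous_on_subset holomorphic_on_imp_continuous_on)
    ultimately have sum0: "contour_integral (linepath (-complex_of_real r) (complex_of_real r)) f +
        contour_integral (part_circlepath 0 r 0 pi) f = 0"
      using contour_integral_join[of f "linepath (-complex_of_real r) (complex_of_real r)" "part_circlepath 0 r 0 pi"]
        contour_integral_unique by fastforce
    have "norm (contour_integral (part_circlepath 0 r 0 pi) f) \<le> C / r\<^sup>2 * r * \<bar>pi - 0\<bar>"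
    proof (rule contour_integral_bound_part_circlepath[OF ci2])
      fix z assume "z \<in> path_image (part_circlepath 0 r 0 pi)"
      then have "norm z = r" using in_path_image_part_circlepath[of z 0 r 0 pi] r0 by simp
      then show "norm (f z) \<le> C / r\<^sup>2" using d[of z] r by simp
    qed (use C r0 in auto)
    moreover have "contour_integral (linepath (-complex_of_real r) (complex_of_real r)) f = I r"
    proof -
      have "contour_integral (linepath (-complex_of_real r) (complex_of_real r)) f
          = integral {-r..r} (\<lambda>x. f (of_real x))"
        using r0 by (subst contour_integral_linepath_Reals_eq) auto
      also have "\<dots> = I r" unfolding I_def
        by (rule set_borel_integral_eq_integral(2)[symmetric])
          (auto simp: set_integrable_def intro!: integrable_mult_indicator int)
      finally show ?thesis .
    qed
    ultimately show ?thesis using sum0 r0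
      by (simp add: add_eq_0_iff power2_eq_square)
  qed
  have "(\<lambda>n. I (real n)) \<longlonglongrightarrow> (LINT x|lborel. f (of_real x))"
    unfolding I_def set_lebesgue_integral_def
  proof (rule integral_dominated_convergence[where w = "\<lambda>x. norm (f (of_real x))"])
    show "AE x in lborel. (\<lambda>n. indicator {- real n..real n} x *\<^sub>R f (of_real x)) \<longlonglongrightarrow> f (complex_of_real x)"
    proof (rule AE_I2, rule tendsto_eventually)
      fix x :: real
      show "eventually (\<lambda>n. indicator {- real n..real n} x *\<^sub>R f (of_real x) = f (complex_of_real x)) sequentially"
        using eventually_ge_at_top[of "nat \<lceil>\<bar>x\<bar>\<rceil>"]
        by eventually_elim (auto simp: indicator_def abs_le_iff nat_le_iff ceiling_le_iff)
    qed
    show "(\<lambda>x. f (complex_of_real x)) \<in> borel_measurable lborel" using int by (rule borel_measurable_integrable)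
    then show "(\<lambda>x. indicator {- real i..real i} x *\<^sub>R f (complex_of_real x)) \<in> borel_measurable lborel" for i
      by measurable
    show "integrable lborel (\<lambda>x. norm (f (complex_of_real x)))" using int by (rule integrable_norm)
  qed (auto simp: indicator_def)
  moreover have "(\<lambda>n. I (real n)) \<longlonglongrightarrow> 0"
  proof (rule Lim_null_comparison)
    show "eventually (\<lambda>n. norm (I (real n)) \<le> C * pi / real n) sequentially"
      using eventually_ge_at_top[of "nat \<lceil>R\<rceil>"]
      by eventually_elim (rule bd, simp add: nat_le_iff ceiling_le_iff)
    show "(\<lambda>n. C * pi / real n) \<longlonglongrightarrow> 0" by (rule lim_const_over_n)
  qed
  ultimately show ?thesis unfolding f_def using LIMSEQ_unique by blast
qed

section \<open>Orthogonal polynomials of a Jacobi matrix\<close>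

abbreviation cpoly :: "real poly \<Rightarrow> complex poly" where
  "cpoly \<equiv> map_poly complex_of_real"

lemma cpoly_add: "cpoly (p + q) = cpoly p + cpoly q"
  by (rule poly_eqI) (simp add: coeff_map_poly)

lemma cpoly_diff: "cpoly (p - q) = cpoly p - cpoly q"
  by (rule poly_eqI) (simp add: coeff_map_poly)

lemma cpoly_smult: "cpoly (smult c p) = smult (of_real c) (cpoly p)"
  by (rule poly_eqI) (simp add: coeff_map_poly)

lemma cpoly_mult: "cpoly (p * q) = cpoly p * cpoly q"
  by (rule poly_eqI) (simp add: coeff_map_poly coeff_mult)

lemma degree_cpoly [simp]: "degree (cpoly p) = degree p"
  by (rule degree_map_poly) simp

lemma poly_cpoly_of_real [simp]: "poly (cpoly p) (complex_of_real x) = complex_of_real (poly p x)"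
  by (induction p) (auto simp: map_poly_pCons)

text \<open>One polynomial in each degree is a triangular basis: cancel the top coefficient and
  recurse. The assumption on \<open>q 0\<close> is separate because the zero polynomial also has
  degree 0.\<close>

lemma poly_expansion:
  fixes q :: "nat \<Rightarrow> 'a::field poly"
  assumes q: "\<And>n. degree (q n) = n" "q 0 \<noteq> 0" and "degree Q \<le> n"
  shows "\<exists>c. Q = (\<Sum>j\<le>n. smult (c j) (q j))"
  using \<open>degree Q \<le> n\<close>
proof (induction n arbitrary: Q)
  case 0
  then obtain d where d: "Q = [:d:]" by (auto elim: degree_eq_zeroE)
  obtain e where e: "q 0 = [:e:]" using q(1)[of 0] by (auto elim: degree_eq_zeroE)
  with q(2) d show ?case by (intro exI[of _ "\<lambda>_. d / e"]) auto
next
  case (Suc n)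
  define e where "e = coeff Q (Suc n) / lead_coeff (q (Suc n))"
  have nz: "lead_coeff (q (Suc n)) \<noteq> 0" using q(1)[of "Suc n"] by (metis degree_0 leading_coeff_0_iff nat.distinct(1))
  have "degree (Q - smult e (q (Suc n))) \<le> n"
  proof (rule degree_le, intro allI impI)
    fix i assume "n < i"
    show "coeff (Q - smult e (q (Suc n))) i = 0"
    proof (cases "i = Suc n")
      case True
      then show ?thesis using nz q(1)[of "Suc n"] by (simp add: e_def)
    next
      case False
      then have "i > Suc n" using \<open>n < i\<close> by simp
      then show ?thesis using Suc.prems q(1)[of "Suc n"] by (simp add: coeff_eq_0)
    qed
  qed
  then obtain c where c: "Q - smult e (q (Suc n)) = (\<Sum>j\<le>n. smult (c j) (q j))"
    using Suc.IH by blast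
  have "(\<Sum>j\<le>Suc n. smult ((c(Suc n := e)) j) (q j)) = (\<Sum>j\<le>n. smult (c j) (q j)) + smult e (q (Suc n))"
    by (auto intro!: sum.cong)
  also have "\<dots> = Q" unfolding c[symmetric] by simp
  finally show ?case by metis
qed

text \<open>The eigenvector recurrence of the symmetric Jacobi matrix with zero diagonal, solved for
  its highest term; the linear case is the same rule with a vanishing polynomial at index
  -1.\<close>

fun jacobi_poly :: "(nat \<Rightarrow> real) \<Rightarrow> nat \<Rightarrow> real poly" where
  "jacobi_poly a 0 = 1"
| "jacobi_poly a (Suc 0) = [:0, 1 / a 0:]"
| "jacobi_poly a (Suc (Suc n)) = smult (1 / a (Suc n))
     (pCons 0 (jacobi_poly a (Suc n)) - smult (a n) (jacobi_poly a n))"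

locale jacobi =
  fixes a :: "nat \<Rightarrow> real"
  assumes a_pos: "a n > 0"
begin

abbreviation p :: "nat \<Rightarrow> real poly" where "p \<equiv> jacobi_poly a"

lemma a_nz [simp]: "a n \<noteq> 0"
  using a_pos[of n] by simp

lemma rec_0: "pCons 0 (p 0) = smult (a 0) (p 1)"
  by (simp add: one_pCons)

lemma rec_Suc: "pCons 0 (p (Suc n)) = smult (a (Suc n)) (p (Suc (Suc n))) + smult (a n) (p n)"
  by simp

lemma poly_rec_Suc: "poly (p (Suc (Suc n))) x = (x * poly (p (Suc n)) x - a n * poly (p n) x) / a (Suc n)"
  by simp

lemma cpoly_rec_0: "poly (cpoly (p (Suc 0))) z = z / a 0"
  by (simp add: map_poly_pCons)

lemma cpoly_rec_Suc: "poly (cpoly (p (Suc (Suc n)))) z =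
    (z * poly (cpoly (p (Suc n))) z - a n * poly (cpoly (p n)) z) / a (Suc n)"
proof -
  have "poly (cpoly (pCons 0 (p (Suc n)))) z =
      poly (cpoly (smult (a (Suc n)) (p (Suc (Suc n))) + smult (a n) (p n))) z"
    by (subst rec_Suc) simp
  then have "z * poly (cpoly (p (Suc n))) z =
     a (Suc n) * poly (cpoly (p (Suc (Suc n)))) z + a n * poly (cpoly (p n)) z"
    unfolding cpoly_add cpoly_smult by (simp add: map_poly_pCons)
  then show ?thesis by simp
qed

declare jacobi_poly.simps(2,3) [simp del]

text \<open>The recurrence reaches back two indices, so the induction carries \<open>n\<close> and
  \<open>n + 1\<close> together.\<close>

lemma degree_lead_p: "degree (p n) = n \<and> lead_coeff (p n) > 0 \<and>
   degree (p (Suc n)) = Suc n \<and> lead_coeff (p (Suc n)) = lead_coeff (p n) / a n"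
proof (induction n)
  case 0
  then show ?case using a_pos[of 0] by (simp add: jacobi_poly.simps)
next
  case (Suc n)
  then have nz: "p (Suc n) \<noteq> 0" by auto
  have d1: "degree (pCons 0 (p (Suc n))) = Suc (Suc n)" using nz Suc by simp
  have d2: "degree (smult (a n) (p n)) < Suc (Suc n)" using Suc by simp
  have d3: "degree (pCons 0 (p (Suc n)) - smult (a n) (p n)) = Suc (Suc n)"
    using d1 d2 degree_add_eq_left[of "- smult (a n) (p n)" "pCons 0 (p (Suc n))"] by simp
  have "coeff (p n) (Suc (Suc n)) = 0" using Suc by (simp add: coeff_eq_0)
  moreover have "lead_coeff (p (Suc n)) > 0" using Suc a_pos[of n] by (metis divide_pos_pos)
  ultimately show ?case using Suc d3 a_pos[of "Suc n"] by (simp add: jacobi_poly.simps)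
qed

lemma degree_p [simp]: "degree (p n) = n"
  and lead_p_pos: "lead_coeff (p n) > 0"
  and lead_p_Suc: "lead_coeff (p (Suc n)) = lead_coeff (p n) / a n"
  using degree_lead_p by blast+

lemma p_nz [simp]: "p n \<noteq> 0"
  using lead_p_pos[of n] by auto

text \<open>The map \<open>m \<mapsto> (z - a n / m) / a (n + 1)\<close> preserves the upper half plane.\<close>
lemma Im_quotient_pos:
  assumes z: "Im z > 0"
  shows "poly (cpoly (p n)) z \<noteq> 0 \<and> Im (poly (cpoly (p (Suc n))) z / poly (cpoly (p n)) z) > 0"
proof (induction n)
  case 0
  show ?case using z a_pos[of 0] by (simp add: cpoly_rec_0)
next
  case (Suc n)
  define m where "m = poly (cpoly (p (Suc n))) z / poly (cpoly (p n)) z"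
  have m: "Im m > 0" "poly (cpoly (p n)) z \<noteq> 0" using Suc by (auto simp: m_def)
  then have nz: "poly (cpoly (p (Suc n))) z \<noteq> 0" by (auto simp: m_def)
  have "poly (cpoly (p (Suc (Suc n)))) z / poly (cpoly (p (Suc n))) z = (z - a n / m) / a (Suc n)"
    using nz m(2) by (simp add: cpoly_rec_Suc m_def field_simps)
  moreover have "Im (of_real (a n) / m) < 0"
  proof -
    have "Im (of_real (a n) / m) = - (a n * Im m) / (cmod m)\<^sup>2"
      by (simp add: Im_divide cmod_power2)
    moreover have "m \<noteq> 0" using m by auto
    ultimately show ?thesis using m(1) a_pos[of n] by (simp add: divide_neg_pos)
  qed
  ultimately show ?case using nz z a_pos[of "Suc n"] by simp
qed

text \<open>A common zero would propagate down the recurrence to the constant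
  \<open>p 0 = 1\<close>.\<close>

lemma no_common_zero: "poly (p n) x \<noteq> 0 \<or> poly (p (Suc n)) x \<noteq> 0"
proof (induction n)
  case (Suc n)
  then show ?case by (auto simp: poly_rec_Suc)
qed simp

lemma sum_squares_pos: "(poly (p n) x)\<^sup>2 + (poly (p (Suc n)) x)\<^sup>2 > 0"
  using no_common_zero[of n x] by (simp add: sum_power2_gt_zero_iff)

text \<open>A Hermite-Biehler polynomial: on the real line its squared modulus is
  \<open>p n^2 + p (n + 1)^2\<close>, the denominator of the density \<open>W n\<close> up to
  constants.\<close>

definition D :: "nat \<Rightarrow> complex poly" where
  "D n = cpoly (p (Suc n)) + smult \<i> (cpoly (p n))"

lemma degree_D [simp]: "degree (D n) = Suc n"
proof -
  have "degree (smult \<i> (cpoly (p n))) < degree (cpoly (p (Suc n)))" by simp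
  then show ?thesis unfolding D_def using degree_add_eq_left by fastforce
qed

lemma coeff_D_Suc: "coeff (D n) (Suc n) = of_real (lead_coeff (p n) / a n)"
  using lead_p_Suc[of n] by (simp add: D_def coeff_map_poly coeff_eq_0)

text \<open>A zero in the open half plane would force the quotient \<open>p (n + 1) / p n\<close> to
  equal \<open>- \<i>\<close>, against its positive imaginary part; a real zero would be a common
  zero of both polynomials.\<close>

lemma D_nz: assumes "Im z \<ge> 0" shows "poly (D n) z \<noteq> 0"
proof (cases "Im z = 0")
  case True
  then obtain x where x: "z = of_real x" by (metis complex_is_Real_iff Reals_cases)
  have "poly (D n) z = Complex (poly (p (Suc n)) x) (poly (p n) x)"
    by (simp add: D_def x complex_eq_iff)
  then show ?thesis using no_common_zero[of n x] by (auto simp: complex_eq_iff)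
next
  case False
  then have z: "Im z > 0" using assms by simp
  show ?thesis
  proof
    assume "poly (D n) z = 0"
    then have "poly (cpoly (p (Suc n))) z / poly (cpoly (p n)) z = - \<i>"
      using Im_quotient_pos[OF z, of n] by (simp add: D_def field_simps add_eq_0_iff)
    then show False using Im_quotient_pos[OF z, of n] by simp
  qed
qed

lemma poly_D_of_real: "poly (D n) (of_real x) = of_real (poly (p (Suc n)) x) + \<i> * of_real (poly (p n) x)"
  by (simp add: D_def)

text \<open>The density obtained by averaging the Gauss quadratures at the zeros of
  \<open>p (n + 1) - \<tau> * p n\<close> against the Cauchy distribution in \<open>\<tau>\<close>; it has the right
  moments up to order \<open>2 n\<close>.\<close>
definition W :: "nat \<Rightarrow> real \<Rightarrow> real" where
  "W n x = 1 / (pi * (a n * ((poly (p n) x)\<^sup>2 + (poly (p (Suc n)) x)\<^sup>2)))"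

lemma W_pos: "W n x > 0"
  unfolding W_def using a_pos sum_squares_pos by (intro divide_pos_pos mult_pos_pos) auto

lemma continuous_W: "continuous_on A (W n)"
proof -
  have "pi * (a n * ((poly (p n) x)\<^sup>2 + (poly (p (Suc n)) x)\<^sup>2)) \<noteq> 0" for x
    using no_common_zero[of n x] by simp
  then show ?thesis unfolding W_def[abs_def] by (intro continuous_intros) auto
qed

text \<open>Squares have positive leading coefficients, so the denominator has degree exactly
  \<open>2 n + 2\<close>, leaving decay of order \<open>1 / x^2\<close>.\<close>

lemma integrable_W: assumes "degree Q \<le> 2 * n" shows "integrable lborel (\<lambda>x. poly Q x * W n x)"
proof -
  define q where "q = smult (pi * a n) ((p n)\<^sup>2 + (p (Suc n))\<^sup>2)"
  have "degree ((p n)\<^sup>2) < degree ((p (Suc n))\<^sup>2)" by (simp add: degree_power_eq)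
  then have "degree ((p n)\<^sup>2 + (p (Suc n))\<^sup>2) = 2 * n + 2"
    by (subst degree_add_eq_right) (auto simp: degree_power_eq)
  then have "degree q = 2 * n + 2" by (simp add: q_def)
  moreover have "poly q x \<noteq> 0" for x
    using no_common_zero[of n x] by (simp add: q_def)
  ultimately have "integrable lborel (\<lambda>x::real. poly Q (of_real x) / poly q (of_real x))"
    using assms by (intro integrable_rational) auto
  then show ?thesis by (simp add: q_def W_def mult.assoc)
qed

text \<open>The moment functional of \<open>W n\<close>. Integrability is guaranteed only up to
  degree \<open>2 n\<close>, and the integral of a non-integrable function is 0 by default; hence
  the degree bounds in \<open>L_add\<close> and \<open>L_sum\<close>.\<close>

definition L :: "nat \<Rightarrow> real poly \<Rightarrow> real" where
  "L n Q = (LINT x|lborel. poly Q x * W n x)"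

lemma L_add: "degree P \<le> 2 * n \<Longrightarrow> degree Q \<le> 2 * n \<Longrightarrow> L n (P + Q) = L n P + L n Q"
  unfolding L_def by (simp add: distrib_right integrable_W Bochner_Integration.integral_add)

lemma L_smult: "L n (smult c Q) = c * L n Q"
  unfolding L_def by (simp add: mult.assoc)

lemma L_sum: assumes "\<And>j. j \<in> A \<Longrightarrow> degree (q j) \<le> 2 * n"
  shows "L n (\<Sum>j\<in>A. smult (c j) (q j)) = (\<Sum>j\<in>A. c j * L n (q j))"
proof -
  have "L n (\<Sum>j\<in>A. smult (c j) (q j)) = (\<Sum>j\<in>A. LINT x|lborel. c j * (poly (q j) x * W n x))"
    unfolding L_def poly_sum sum_distrib_right
    by (subst Bochner_Integration.integral_sum[symmetric])
       (auto simp: mult.assoc intro!: integrable_mult_right integrable_W assms)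
  then show ?thesis by (simp add: L_def)
qed

text \<open>On the real line \<open>1 / D n\<close> is the conjugate of \<open>D n\<close> times
  \<open>pi * a n * W n\<close>. One complex integral over \<open>D n\<close> therefore contains two
  integrals against \<open>W n\<close>, one with \<open>p (n + 1)\<close> and one with
  \<open>p n\<close>.\<close>

lemma divide_D:
  "of_real y / poly (D n) (of_real x) =
    Complex (y * poly (p (Suc n)) x * (pi * a n * W n x)) (- (y * poly (p n) x * (pi * a n * W n x)))"
proof -
  have "(poly (p (Suc n)) x)\<^sup>2 + (poly (p n) x)\<^sup>2 \<noteq> 0" using no_common_zero[of n x] by auto
  then show ?thesis unfolding poly_D_of_real W_def
    by (simp add: complex_eq_iff Re_divide Im_divide add.commute)
qed

text \<open>For such \<open>P\<close> the quotient \<open>P / D n\<close> is analytic in the closed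
  upper half plane and decays like \<open>1 / z^2\<close>, so its integral vanishes; real and
  imaginary parts give the two claims.\<close>

lemma L_orth_top:
  assumes "degree P < n"
  shows "L n (P * p n) = 0" "L n (P * p (Suc n)) = 0"
proof -
  let ?f = "\<lambda>x. poly (cpoly P) (of_real x) / poly (D n) (of_real x)"
  have i: "complex_integrable lborel ?f"
    using assms by (intro integrable_rational) (auto simp: D_nz)
  have 0: "(LINT x|lborel. ?f x) = 0"
    using assms by (intro integral_rational_eq_0) (auto simp: D_nz)
  have eq: "?f x = Complex (poly P x * poly (p (Suc n)) x * (pi * a n * W n x)) (- (poly P x * poly (p n) x * (pi * a n * W n x)))" for x
    unfolding poly_cpoly_of_real by (rule divide_D)
  have "(LINT x|lborel. Re (?f x)) = 0" "(LINT x|lborel. Im (?f x)) = 0"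
    using integral_Re[OF i] integral_Im[OF i] unfolding 0 by simp_all
  then have "pi * a n * L n (P * p (Suc n)) = 0" "pi * a n * L n (P * p n) = 0"
    unfolding eq L_def by (simp_all add: mult_ac flip: integral_mult_right_zero)
  then show "L n (P * p n) = 0" "L n (P * p (Suc n)) = 0" by simp_all
qed

text \<open>Subtracting \<open>a n / (z + \<i>)\<close> removes the leading behaviour of \<open>p n / D n\<close> at infinity; its
  imaginary part on the real line is the Cauchy density.\<close>
lemma L_norm_top: "L n (p n * p n) = 1"
proof -
  define N where "N = cpoly (p n) * [:\<i>, 1:] - smult (of_real (a n)) (D n)"
  define q where "q = D n * [:\<i>, 1:]"
  have Dn: "D n \<noteq> 0" using D_nz[of 0 n] by auto
  \<comment> \<open>The coefficients at degree \<open>n + 1\<close> cancel, since the leading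
    coefficient of \<open>D n\<close> is that of \<open>p n\<close> divided by \<open>a n\<close>.
    This gains the degree needed for decay of order \<open>1 / z^2\<close>.\<close>
  have degN: "degree N \<le> n"
  proof (rule degree_le, intro allI impI)
    fix k assume k: "n < k"
    show "coeff N k = 0"
    proof (cases "k = Suc n")
      case True
      then show ?thesis
        by (simp add: N_def coeff_D_Suc coeff_map_poly coeff_eq_0)
    next
      case False
      then obtain j where "k = Suc j" "j > n" using k by (cases k) auto
      then show ?thesis using k by (simp add: N_def coeff_map_poly coeff_eq_0)
    qed
  qed
  have degq: "degree q = n + 2" unfolding q_def using Dn by (subst degree_mult_eq) auto
  have qnz: "poly q z \<noteq> 0" if "Im z \<ge> 0" for z
  proof -
    have "\<i> + z \<noteq> 0" using that by (auto simp: complex_eq_iff)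
    moreover have "poly q z = poly (D n) z * (\<i> + z)" by (simp add: q_def algebra_simps)
    ultimately show ?thesis using D_nz[OF that, of n] by simp
  qed
  let ?f = "\<lambda>x. poly N (of_real x) / poly q (of_real x)"
  have i: "complex_integrable lborel ?f"
    using degN degq by (intro integrable_rational) (auto simp: qnz)
  have 0: "(LINT x|lborel. ?f x) = 0"
    using degN degq by (intro integral_rational_eq_0) (auto simp: qnz)
  have Im_eq: "Im (?f x) = a n * (1 / (1 + x\<^sup>2)) - pi * a n * (poly (p n * p n) x * W n x)" for x
  proof -
    have nz: "\<i> + of_real x \<noteq> 0" "poly (D n) (of_real x) \<noteq> 0"
      using D_nz[of "of_real x" n] by (auto simp: complex_eq_iff)
    then have "?f x = of_real (poly (p n) x) / poly (D n) (of_real x) - of_real (a n) / (\<i> + of_real x)"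
      by (simp add: N_def q_def field_simps)
    moreover have "Im (of_real (a n) / (\<i> + of_real x)) = - (a n * (1 / (1 + x\<^sup>2)))"
      by (simp add: Im_divide add.commute)
    ultimately show ?thesis unfolding divide_D by simp
  qed
  have "0 = (LINT x|lborel. Im (?f x))" using integral_Im[OF i] unfolding 0 by simp
  also have "\<dots> = (LINT x|lborel. a n * (1 / (1 + x\<^sup>2))) - (LINT x|lborel. pi * a n * (poly (p n * p n) x * W n x))"
    unfolding Im_eq
    by (intro Bochner_Integration.integral_diff integrable_mult_right integrable_inverse_1_plus_square_lborel integrable_W)
       (simp add: degree_mult_eq)
  also have "\<dots> = a n * pi - pi * a n * L n (p n * p n)"
    unfolding L_def integral_mult_right_zero integral_inverse_1_plus_square_lborel by simp
  finally show ?thesis by simp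
qed

text \<open>Downward induction from the top pair, using
  \<open>a m * p m = x * p (m + 1) - a (m + 1) * p (m + 2)\<close>. The extra bound
  \<open>degree P < n\<close> matters at \<open>m = n\<close>, where \<open>P * p (n + 1)\<close>
  could otherwise have degree \<open>2 n + 1\<close>, beyond the range of integrability.\<close>

lemma L_orth_aux:
  assumes "m \<le> n"
  shows "(\<forall>P. degree P < m \<longrightarrow> L n (P * p m) = 0) \<and>
         (\<forall>P. degree P < Suc m \<longrightarrow> degree P < n \<longrightarrow> L n (P * p (Suc m)) = 0) \<and>
         L n (p m * p m) = 1"
  using assms
proof (induction m rule: inc_induct)
  case base
  show ?case using L_orth_top L_norm_top by blast
next
  case (step m)
  then have IH1: "L n (P * p (Suc m)) = 0" if "degree P < Suc m" for P
    using that by blast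
  have IH2: "L n (P * p (Suc (Suc m))) = 0" if "degree P < Suc (Suc m)" "degree P < n" for P
    using step.IH that by blast
  have IH3: "L n (p (Suc m) * p (Suc m)) = 1" using step.IH by blast
  have mn: "Suc m \<le> n" using step by simp
  have down: "a m * L n (P * p m) = L n (pCons 0 P * p (Suc m)) - a (Suc m) * L n (P * p (Suc (Suc m)))"
    if "degree P \<le> m" for P
  proof -
    have "smult (a m) (P * p m) = pCons 0 P * p (Suc m) + smult (- a (Suc m)) (P * p (Suc (Suc m)))"
    proof -
      have "smult (a m) (p m) = pCons 0 (p (Suc m)) - smult (a (Suc m)) (p (Suc (Suc m)))"
        using rec_Suc[of m] by simp
      then have "P * smult (a m) (p m) = P * (pCons 0 (p (Suc m)) - smult (a (Suc m)) (p (Suc (Suc m))))"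
        by simp
      then show ?thesis by (simp add: algebra_simps)
    qed
    then have "L n (smult (a m) (P * p m)) = L n (pCons 0 P * p (Suc m) + smult (- a (Suc m)) (P * p (Suc (Suc m))))"
      by simp
    also have "\<dots> = L n (pCons 0 P * p (Suc m)) + L n (smult (- a (Suc m)) (P * p (Suc (Suc m))))"
    proof (rule L_add)
      have "degree (pCons 0 P) \<le> Suc m" using that degree_pCons_le[of 0 P] by linarith
      then show "degree (pCons 0 P * p (Suc m)) \<le> 2 * n"
        using degree_mult_le[of "pCons 0 P" "p (Suc m)"] mn unfolding degree_p by linarith
      show "degree (smult (- a (Suc m)) (P * p (Suc (Suc m)))) \<le> 2 * n"
        using degree_mult_le[of P "p (Suc (Suc m))"] mn that unfolding degree_p
        by (intro order_trans[OF degree_smult_le]) linarith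
    qed
    finally show ?thesis unfolding L_smult by simp
  qed
  have 1: "L n (P * p m) = 0" if "degree P < m" for P
  proof -
    have "degree (pCons 0 P) < Suc m" using that degree_pCons_le[of 0 P] by linarith
    then show ?thesis using down[of P] IH1[of "pCons 0 P"] IH2[of P] that mn by simp
  qed
  have 2: "L n (p m * p m) = 1"
  proof -
    \<comment> \<open>Expanding \<open>x * p m\<close> by the recurrence leaves \<open>a m\<close>
      times the norm of \<open>p (m + 1)\<close>, because \<open>p (m - 1)\<close> is orthogonal to
      it.\<close>
    have "L n (pCons 0 (p m) * p (Suc m)) = a m"
    proof (cases m)
      case 0
      then show ?thesis unfolding 0 rec_0 using IH3 0 by (simp add: L_smult)
    next
      case (Suc k)
      have "L n (pCons 0 (p m) * p (Suc m)) = L n (smult (a m) (p (Suc m) * p (Suc m)) + smult (a k) (p k * p (Suc m)))"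
        unfolding Suc rec_Suc by (simp add: algebra_simps)
      also have "\<dots> = L n (smult (a m) (p (Suc m) * p (Suc m))) + L n (smult (a k) (p k * p (Suc m)))"
        using mn Suc by (intro L_add) (auto simp: degree_mult_eq)
      also have "\<dots> = a m" using IH3 IH1[of "p k"] Suc by (simp add: L_smult)
      finally show ?thesis .
    qed
    moreover have "L n (p m * p (Suc (Suc m))) = 0" using IH2[of "p m"] mn by simp
    ultimately show ?thesis using down[of "p m"] by simp
  qed
  show ?case using 1 2 IH1 by blast
qed

lemma L_orthonormal:
  assumes "i \<le> n" "j \<le> n"
  shows "L n (p i * p j) = (if i = j then 1 else 0)"
proof -
  consider "i < j" | "i = j" | "j < i" by linarith
  then show ?thesis
  proof cases
    case 1
    then show ?thesis using L_orth_aux[of j n] assms by simp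
  next
    case 2
    then show ?thesis using L_orth_aux[of j n] assms by simp
  next
    case 3
    then show ?thesis using L_orth_aux[of i n] assms by (simp add: mult.commute[of "p i" "p j"])
  qed
qed

text \<open>As \<open>p 0 = 1\<close>, orthonormality makes \<open>L n\<close> pick out the
  coefficient of \<open>p 0\<close> in the expansion of \<open>Q\<close>, and this coefficient does
  not depend on \<open>n\<close>.\<close>

lemma L_eventually_const: "\<exists>c. \<forall>n\<ge>degree Q. L n Q = c"
proof -
  obtain c where c: "Q = (\<Sum>j\<le>degree Q. smult (c j) (p j))"
    using poly_expansion[of p Q "degree Q"] by auto
  have "L n Q = c 0" if n: "n \<ge> degree Q" for n
  proof -
    have "L n Q = (\<Sum>j\<le>degree Q. c j * L n (p j))"
      using n by (subst c, intro L_sum) auto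
    also have "\<dots> = (\<Sum>j\<le>degree Q. c j * (if j = 0 then 1 else 0))"
      using L_orthonormal[of _ n 0] n by (intro sum.cong) auto
    also have "\<dots> = c 0" by (subst sum.remove[of _ 0]) auto
    finally show ?thesis .
  qed
  then show ?thesis by blast
qed

end

section \<open>Limits of densities with stationary moments\<close>

text \<open>Fatou's lemma. It yields integrability in the limit but only an inequality; equality of
  moments needs the tail estimate that follows.\<close>

lemma eventually_integral_limit_le:
  fixes V w :: "real \<Rightarrow> real" and v :: "nat \<Rightarrow> real \<Rightarrow> real"
  assumes [measurable]: "V \<in> borel_measurable borel" "\<And>k. v k \<in> borel_measurable borel" "w \<in> borel_measurable borel"
    and nn: "\<And>x. V x \<ge> 0" "\<And>k x. v k x \<ge> 0" and lim: "\<And>x. (\<lambda>k. v k x) \<longlonglongrightarrow> w x"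
    and ev: "\<forall>\<^sub>F k in sequentially. integrable lborel (\<lambda>x. V x * v k x) \<and> (LINT x|lborel. V x * v k x) = c"
  shows "integrable lborel (\<lambda>x. V x * w x)" "(LINT x|lborel. V x * w x) \<le> c"
proof -
  have w0: "w x \<ge> 0" for x by (rule LIMSEQ_le_const[OF lim]) (use nn in auto)
  have c0: "c \<ge> 0"
  proof -
    obtain k where "(LINT x|lborel. V x * v k x) = c" using eventually_happens[OF ev] by auto
    moreover have "(LINT x|lborel. V x * v k x) \<ge> 0" using nn by (intro Bochner_Integration.integral_nonneg) auto
    ultimately show ?thesis by simp
  qed
  have evc: "\<forall>\<^sub>F k in sequentially. (\<integral>\<^sup>+x. ennreal (V x * v k x) \<partial>lborel) = ennreal c"
    using ev by eventually_elim (subst nn_integral_eq_integral, auto simp: nn)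
  have "(\<integral>\<^sup>+x. ennreal (V x * w x) \<partial>lborel) = (\<integral>\<^sup>+x. liminf (\<lambda>k. ennreal (V x * v k x)) \<partial>lborel)"
  proof (intro nn_integral_cong)
    fix x
    have "(\<lambda>k. ennreal (V x * v k x)) \<longlonglongrightarrow> ennreal (V x * w x)"
      by (intro tendsto_intros lim tendsto_ennrealI)
    then show "ennreal (V x * w x) = liminf (\<lambda>k. ennreal (V x * v k x))"
      by (metis lim_imp_Liminf trivial_limit_sequentially)
  qed
  also have "\<dots> \<le> liminf (\<lambda>k. \<integral>\<^sup>+x. ennreal (V x * v k x) \<partial>lborel)"
    by (rule nn_integral_liminf) simp
  also have "\<dots> = ennreal c"
    using tendsto_eventually[OF evc] by (metis lim_imp_Liminf trivial_limit_sequentially)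
  finally have le: "(\<integral>\<^sup>+x. ennreal (V x * w x) \<partial>lborel) \<le> ennreal c" .
  show i: "integrable lborel (\<lambda>x. V x * w x)"
    using le nn w0 by (intro integrableI_bounded) (auto simp: abs_mult top.not_eq_extremum intro: le_less_trans)
  show "(LINT x|lborel. V x * w x) \<le> c"
    using le nn w0 c0 by (subst (asm) nn_integral_eq_integral[OF i]) auto
qed

text \<open>Outside the interval, \<open>\<bar>Q\<bar> \<le> 1 + Q^2\<close> and
  \<open>1 \<le> x^2 / R^2\<close>. The bound is itself a moment, hence uniform along densities with
  eventually constant moments.\<close>

lemma integral_tail_le:
  fixes Q :: "real poly"
  assumes i: "integrable lborel (\<lambda>x. poly Q x * g x)" "integrable lborel (\<lambda>x. poly (monom 1 2 * (1 + Q\<^sup>2)) x * g x)"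
    and g: "\<And>x. g x \<ge> 0" and R: "R > 0"
  shows "\<bar>(LINT x|lborel. poly Q x * g x) - (LINT x|lborel. indicator {-R..R} x * (poly Q x * g x))\<bar>
     \<le> (LINT x|lborel. poly (monom 1 2 * (1 + Q\<^sup>2)) x * g x) / R\<^sup>2"
proof -
  have i2: "integrable lborel (\<lambda>x. indicator {-R..R} x * (poly Q x * g x))"
    using integrable_mult_indicator[OF _ i(1), of "{-R..R}"] by simp
  have "\<bar>(LINT x|lborel. poly Q x * g x) - (LINT x|lborel. indicator {-R..R} x * (poly Q x * g x))\<bar>
     = \<bar>LINT x|lborel. poly Q x * g x - indicator {-R..R} x * (poly Q x * g x)\<bar>"
    by (subst Bochner_Integration.integral_diff[OF i(1) i2]) simp
  also have "\<dots> \<le> (LINT x|lborel. \<bar>poly Q x * g x - indicator {-R..R} x * (poly Q x * g x)\<bar>)"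
    by (rule integral_abs_bound)
  also have "\<dots> \<le> (LINT x|lborel. poly (monom 1 2 * (1 + Q\<^sup>2)) x * g x / R\<^sup>2)"
  proof (rule integral_mono)
    show "integrable lborel (\<lambda>x. \<bar>poly Q x * g x - indicator {-R..R} x * (poly Q x * g x)\<bar>)"
      using i(1) i2 by (intro integrable_abs Bochner_Integration.integrable_diff)
    show "integrable lborel (\<lambda>x. poly (monom 1 2 * (1 + Q\<^sup>2)) x * g x / R\<^sup>2)"
      using i(2) by (rule integrable_divide)
    fix x
    show "\<bar>poly Q x * g x - indicator {-R..R} x * (poly Q x * g x)\<bar> \<le> poly (monom 1 2 * (1 + Q\<^sup>2)) x * g x / R\<^sup>2"
    proof (cases "x \<in> {-R..R}")
      case True
      then show ?thesis using g[of x] by (simp add: poly_monom)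
    next
      case False
      then have "R < \<bar>x\<bar>" by auto
      then have x: "R\<^sup>2 \<le> x\<^sup>2" using R by (simp add: abs_le_square_iff[symmetric])
      have "\<bar>poly Q x\<bar> \<le> 1 + (poly Q x)\<^sup>2"
        using sum_squares_bound[of "\<bar>poly Q x\<bar>" 1] by (simp add: power2_eq_square)
      then have "\<bar>poly Q x\<bar> * R\<^sup>2 \<le> (1 + (poly Q x)\<^sup>2) * x\<^sup>2"
        using x by (intro mult_mono) auto
      then have "\<bar>poly Q x\<bar> * R\<^sup>2 * g x \<le> (1 + (poly Q x)\<^sup>2) * x\<^sup>2 * g x"
        using g by (intro mult_right_mono)
      then show ?thesis using False g[of x] R
        by (simp add: abs_mult poly_monom field_simps)
    qed
  qed
  finally show ?thesis by simp
qed

text \<open>Eventually constant moments give tightness, so that pointwise convergence of the densities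
  entails convergence of the moments.\<close>
lemma poly_moment_limit:
  fixes v :: "nat \<Rightarrow> real \<Rightarrow> real" and w :: "real \<Rightarrow> real" and Q :: "real poly"
  assumes meas [measurable]: "\<And>k. v k \<in> borel_measurable borel" "w \<in> borel_measurable borel"
    and nn: "\<And>k x. v k x \<ge> 0" and lim: "\<And>x. (\<lambda>k. v k x) \<longlonglongrightarrow> w x"
    and bd: "\<And>R. \<exists>B. \<forall>\<^sub>F k in sequentially. \<forall>x\<in>{-R..R}. v k x \<le> B"
    and ev: "\<And>Q. \<exists>c. \<forall>\<^sub>F k in sequentially. integrable lborel (\<lambda>x. poly Q x * v k x) \<and> (LINT x|lborel. poly Q x * v k x) = c"
  shows "integrable lborel (\<lambda>x. poly Q x * w x)"
    and "\<forall>\<^sub>F k in sequentially. (LINT x|lborel. poly Q x * v k x) = (LINT x|lborel. poly Q x * w x)"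
proof -
  have [measurable]: "poly P \<in> borel_measurable borel" for P :: "real poly"
    by (intro borel_measurable_continuous_onI continuous_intros)
  have w0: "w x \<ge> 0" for x by (rule LIMSEQ_le_const[OF lim]) (use nn in auto)
  show iw: "integrable lborel (\<lambda>x. poly Q x * w x)" for Q
  proof -
    \<comment> \<open>Fatou needs a nonnegative integrand, so it is applied to the majorant
      \<open>1 + Q^2\<close> of the possibly signed \<open>Q\<close>.\<close>
    obtain c where c: "\<forall>\<^sub>F k in sequentially. integrable lborel (\<lambda>x. poly (1 + Q\<^sup>2) x * v k x) \<and>
       (LINT x|lborel. poly (1 + Q\<^sup>2) x * v k x) = c" using ev by blast
    have "integrable lborel (\<lambda>x. poly (1 + Q\<^sup>2) x * w x)"
      by (rule eventually_integral_limit_le(1)[OF _ _ _ _ nn lim c]) auto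
    then show ?thesis
    proof (rule Bochner_Integration.integrable_bound)
      have "\<bar>poly Q x\<bar> \<le> 1 + (poly Q x)\<^sup>2" for x
        using sum_squares_bound[of "\<bar>poly Q x\<bar>" 1] by (simp add: power2_eq_square)
      then show "AE x in lborel. norm (poly Q x * w x) \<le> norm (poly (1 + Q\<^sup>2) x * w x)"
        using w0 by (intro AE_I2) (auto simp: abs_mult intro!: mult_right_mono order_trans[OF _ abs_ge_self])
    qed simp
  qed
  define V where "V = monom 1 2 * (1 + Q\<^sup>2)"
  obtain c where c: "\<forall>\<^sub>F k in sequentially. integrable lborel (\<lambda>x. poly Q x * v k x) \<and>
       (LINT x|lborel. poly Q x * v k x) = c" using ev by blast
  obtain d where d: "\<forall>\<^sub>F k in sequentially. integrable lborel (\<lambda>x. poly V x * v k x) \<and>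
       (LINT x|lborel. poly V x * v k x) = d" using ev by blast
  have dw: "(LINT x|lborel. poly V x * w x) \<le> d"
    by (rule eventually_integral_limit_le(2)[OF _ _ _ _ nn lim d]) (auto simp: V_def poly_monom)
  \<comment> \<open>One tail for \<open>v k\<close> and one for \<open>w\<close> cost
    \<open>d / R^2\<close> each; the integrals over the interval converge by dominated
    convergence.\<close>
  have main: "\<bar>c - (LINT x|lborel. poly Q x * w x)\<bar> \<le> 2 * d / R\<^sup>2" if R: "R > 0" for R
  proof -
    define J where "J = (\<lambda>k. LINT x|lborel. indicator {-R..R} x * (poly Q x * v k x))"
    define Jw where "Jw = (LINT x|lborel. indicator {-R..R} x * (poly Q x * w x))"
    have 1: "\<forall>\<^sub>F k in sequentially. \<bar>c - J k\<bar> \<le> d / R\<^sup>2"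
      using c d
    proof eventually_elim
      case (elim k)
      then show ?case using integral_tail_le[of Q "v k" R] nn R by (auto simp: J_def V_def)
    qed
    have 2: "\<bar>(LINT x|lborel. poly Q x * w x) - Jw\<bar> \<le> d / R\<^sup>2"
    proof -
      have "\<bar>(LINT x|lborel. poly Q x * w x) - Jw\<bar> \<le> (LINT x|lborel. poly V x * w x) / R\<^sup>2"
        unfolding Jw_def V_def by (rule integral_tail_le[OF iw iw w0 R])
      also have "\<dots> \<le> d / R\<^sup>2" using dw by (intro divide_right_mono) auto
      finally show ?thesis .
    qed
    obtain B where "\<forall>\<^sub>F k in sequentially. \<forall>x\<in>{-R..R}. v k x \<le> B" using bd by blast
    then obtain N where N: "\<And>k x. k \<ge> N \<Longrightarrow> x \<in> {-R..R} \<Longrightarrow> v k x \<le> B"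
      unfolding eventually_sequentially by blast
    have "compact (poly Q ` {-R..R})" by (intro compact_continuous_image continuous_intros) auto
    then have "bounded (poly Q ` {-R..R})" by (rule compact_imp_bounded)
    then obtain E where E: "\<And>x. x \<in> {-R..R} \<Longrightarrow> \<bar>poly Q x\<bar> \<le> E"
      unfolding bounded_iff by (metis imageI real_norm_def)
    have "(\<lambda>k. J (k + N)) \<longlonglongrightarrow> Jw"
      unfolding J_def Jw_def
    proof (rule integral_dominated_convergence[where w = "\<lambda>x. E * B * indicator {-R..R} x"])
      show "integrable lborel (\<lambda>x. E * B * indicator {-R..R} x)"
        using R by (intro integrable_mult_right integrable_real_indicator) auto
      show "AE x in lborel. (\<lambda>i. indicator {- R..R} x * (poly Q x * v (i + N) x)) \<longlonglongrightarrow> indicator {- R..R} x * (poly Q x * w x)"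
        by (intro AE_I2 tendsto_intros LIMSEQ_ignore_initial_segment lim)
      show "AE x in lborel. norm (indicator {- R..R} x * (poly Q x * v (i + N) x)) \<le> E * B * indicator {- R..R} x" for i
        using N E nn by (intro AE_I2) (auto simp: indicator_def abs_mult intro!: mult_mono order_trans[OF abs_ge_zero E])
    qed simp_all
    then have "J \<longlonglongrightarrow> Jw" by (rule LIMSEQ_offset)
    then have "(\<lambda>k. \<bar>c - J k\<bar>) \<longlonglongrightarrow> \<bar>c - Jw\<bar>" by (intro tendsto_intros)
    then have "\<bar>c - Jw\<bar> \<le> d / R\<^sup>2" using 1 by (intro tendsto_upperbound) auto
    moreover have "2 * d / R\<^sup>2 = d / R\<^sup>2 + d / R\<^sup>2" by simp
    ultimately show ?thesis using 2 by linarith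
  qed
  have "(\<lambda>n. 2 * d / (real n)\<^sup>2) \<longlonglongrightarrow> 0"
    by real_asymp
  moreover have "\<forall>\<^sub>F n in sequentially. \<bar>c - (LINT x|lborel. poly Q x * w x)\<bar> \<le> 2 * d / (real n)\<^sup>2"
    using eventually_gt_at_top[of 0] by eventually_elim (rule main, simp)
  ultimately have "\<bar>c - (LINT x|lborel. poly Q x * w x)\<bar> \<le> 0"
    by (intro tendsto_lowerbound) auto
  then show "\<forall>\<^sub>F k in sequentially. (LINT x|lborel. poly Q x * v k x) = (LINT x|lborel. poly Q x * w x)"
    using c by (auto elim!: eventually_mono)
qed

section \<open>Uniqueness of the orthonormal polynomials of a weight\<close>

lemma admissible_weight_poly_integrable:
  assumes "admissible_weight w"
  shows "integrable lborel (\<lambda>x. poly Q x * w x)"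
proof -
  have "integrable lborel (\<lambda>x. \<Sum>i\<le>degree Q. coeff Q i * (x ^ i * w x))"
    using assms unfolding admissible_weight_def
    by (intro Bochner_Integration.integrable_sum integrable_mult_right) auto
  then show ?thesis by (simp add: poly_altdef sum_distrib_right mult.assoc)
qed

text \<open>In the expansion of \<open>r n\<close> along \<open>q\<close>, orthogonality to lower
  degrees kills all coefficients but the last, normalization makes its square 1, and positive
  leading coefficients fix its sign.\<close>

lemma orthonormal_polys_unique:
  assumes w: "admissible_weight w" and q: "orthonormal_polys w q" and r: "orthonormal_polys w r"
  shows "q = r"
proof
  fix n
  define I where "I = (\<lambda>P. LINT x|lborel. poly P x * w x)"
  note int = admissible_weight_poly_integrable[OF w]
  have I_sum: "I (\<Sum>j\<in>A. smult (c j) (P j)) = (\<Sum>j\<in>A. c j * I (P j))" for A :: "nat set" and c P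
    unfolding I_def poly_sum sum_distrib_right
    by (subst Bochner_Integration.integral_sum) (auto simp: mult.assoc intro!: integrable_mult_right int)
  have orth: "I (s i * s j) = (if i = j then 1 else 0)" if "orthonormal_polys w s" for s i j
    using that unfolding I_def orthonormal_polys_def by simp
  have deg: "degree (s i) = i" "lead_coeff (s i) > 0" "s 0 \<noteq> 0" if "orthonormal_polys w s" for s i
    using that leading_coeff_0_iff unfolding orthonormal_polys_def by (blast, blast, metis less_irrefl)
  have low: "I (P * s n) = 0" if s: "orthonormal_polys w s" and P: "degree P < n" for s P
  proof -
    obtain c where c: "P = (\<Sum>j\<le>degree P. smult (c j) (s j))"
      using poly_expansion[of s P "degree P"] deg[OF s] by auto
    have "P * s n = (\<Sum>j\<le>degree P. smult (c j) (s j * s n))"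
      by (subst c) (simp add: sum_distrib_right)
    then have "I (P * s n) = (\<Sum>j\<le>degree P. c j * I (s j * s n))" by (simp add: I_sum)
    also have "\<dots> = 0" using P by (intro sum.neutral) (auto simp: orth[OF s])
    finally show ?thesis .
  qed
  obtain c where c: "r n = (\<Sum>j\<le>n. smult (c j) (q j))"
    using poly_expansion[of q "r n" n] deg[OF q] deg(1)[OF r] by auto
  have "c i = 0" if i: "i < n" for i
  proof -
    have "q i * r n = (\<Sum>j\<le>n. smult (c j) (q i * q j))"
      by (subst c) (simp add: sum_distrib_left)
    then have "I (q i * r n) = (\<Sum>j\<le>n. c j * I (q i * q j))" by (simp add: I_sum)
    also have "\<dots> = (\<Sum>j\<le>n. if j = i then c i else 0)" by (intro sum.cong) (auto simp: orth[OF q])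
    also have "\<dots> = c i" using i by simp
    finally show ?thesis using low[OF r, of "q i"] deg(1)[OF q] i by simp
  qed
  then have rq: "r n = smult (c n) (q n)"
    by (subst c) (simp add: sum.remove[of "{..n}" n])
  have "I (r n * r n) = c n * c n * I (q n * q n)"
    unfolding rq I_def by (simp add: mult_ac flip: integral_mult_right_zero)
  then have "c n * c n = 1" using orth[OF q, of n n] orth[OF r, of n n] by simp
  moreover have "lead_coeff (r n) = c n * lead_coeff (q n)" by (simp add: rq)
  then have "c n > 0" using deg(2)[OF q, of n] deg(2)[OF r, of n] by (simp add: zero_less_mult_iff)
  ultimately have "c n = 1" by (simp add: square_eq_1_iff)
  then show "q n = r n" using rq by simp
qed

section \<open>Density of polynomials\<close>

lemma sum_power2_le: "(x + y)\<^sup>2 \<le> 2 * x\<^sup>2 + 2 * (y::real)\<^sup>2"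
  using sum_squares_bound[of x y] by (simp add: power2_sum)

text \<open>The Newton-Schulz iteration for the sign function. Each step is a polynomial operation,
  so it stays inside any algebra of functions, while the pointwise limit on \<open>[-1, 1]\<close>
  is \<open>sgn\<close>.\<close>

primrec sgn_iter :: "nat \<Rightarrow> real \<Rightarrow> real" where
  "sgn_iter 0 t = t"
| "sgn_iter (Suc n) t = (3 * sgn_iter n t - sgn_iter n t ^ 3) / 2"

lemma sgn_iter_pos:
  assumes "0 < t" "t \<le> 1"
  shows "0 < sgn_iter n t \<and> sgn_iter n t \<le> 1 \<and> sgn_iter n t \<le> sgn_iter (Suc n) t"
proof -
  have step: "s \<le> (3 * s - s ^ 3) / 2 \<and> (3 * s - s ^ 3) / 2 \<le> 1" if "0 < s" "s \<le> 1" for s :: real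
  proof -
    have "s * s \<le> 1" using that by (simp add: mult_le_one)
    then have "s * (s * s) \<le> s * 1" using that by (intro mult_left_mono) auto
    \<comment> \<open>This product equals \<open>2 - (3 * s - s ^ 3)\<close>, so its sign is the
      upper bound 1.\<close>
    moreover have "0 \<le> (1 - s) * (1 - s) * (2 + s)" using that by simp
    ultimately show ?thesis by (simp add: power3_eq_cube algebra_simps)
  qed
  show ?thesis
  proof (induction n)
    case 0
    then show ?case using assms step[of t] by simp
  next
    case (Suc n)
    then have "0 < sgn_iter (Suc n) t" "sgn_iter (Suc n) t \<le> 1" using step[of "sgn_iter n t"] by auto
    then show ?case using step[of "sgn_iter (Suc n) t"] by simp
  qed
qed

lemma sgn_iter_uminus: "sgn_iter n (- t) = - sgn_iter n t"
  by (induction n) (auto simp: field_simps)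

lemma sgn_iter_zero [simp]: "sgn_iter n 0 = 0"
  by (induction n) auto

lemma sgn_iter_tendsto_pos:
  assumes "0 < t" "t \<le> 1"
  shows "(\<lambda>n. sgn_iter n t) \<longlonglongrightarrow> 1"
proof -
  have "incseq (\<lambda>n. sgn_iter n t)" using sgn_iter_pos[OF assms] by (intro incseq_SucI) auto
  then obtain l where l: "(\<lambda>n. sgn_iter n t) \<longlonglongrightarrow> l" and le: "\<And>n. sgn_iter n t \<le> l"
    using incseq_convergent[of "\<lambda>n. sgn_iter n t" 1] sgn_iter_pos[OF assms] by metis
  have "l > 0" using le[of 0] assms by simp
  have "(\<lambda>n. sgn_iter (Suc n) t) \<longlonglongrightarrow> (3 * l - l ^ 3) / 2"
    unfolding sgn_iter.simps by (intro tendsto_intros l) auto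
  then have "l = (3 * l - l ^ 3) / 2" using LIMSEQ_Suc[OF l] LIMSEQ_unique by blast
  then have "l * (l * l) = l * 1" by (simp add: power3_eq_cube)
  then have "l * l = 1" using \<open>l > 0\<close> mult_left_cancel[of l "l * l" 1] by simp
  then have "l = 1" using \<open>l > 0\<close> by (simp add: square_eq_1_iff)
  then show ?thesis using l by simp
qed

lemma sgn_iter_tendsto: assumes "\<bar>t\<bar> \<le> 1" shows "(\<lambda>n. sgn_iter n t) \<longlonglongrightarrow> sgn t"
proof -
  consider "t > 0" | "t = 0" | "t < 0" by linarith
  then show ?thesis
  proof cases
    case 3
    then have "(\<lambda>n. - sgn_iter n (- t)) \<longlonglongrightarrow> - 1"
      using assms by (intro tendsto_intros sgn_iter_tendsto_pos) auto
    then show ?thesis using 3 by (simp add: sgn_iter_uminus)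
  qed (use sgn_iter_tendsto_pos assms in auto)
qed

lemma abs_sgn_iter_le: assumes "\<bar>t\<bar> \<le> 1" shows "\<bar>sgn_iter n t\<bar> \<le> 1"
proof -
  consider "t > 0" | "t = 0" | "t < 0" by linarith
  then show ?thesis
  proof cases
    case 1
    then show ?thesis using sgn_iter_pos[of t n] assms by auto
  next
    case 3
    then show ?thesis using sgn_iter_pos[of "-t" n] assms by (auto simp: sgn_iter_uminus)
  qed auto
qed

lemma mod_one_plus_square:
  fixes Q :: "real poly"
  shows "Q mod [:1, 0, 1:] = [:coeff (Q mod [:1, 0, 1:]) 0, coeff (Q mod [:1, 0, 1:]) 1:]"
proof -
  have "degree (Q mod [:1, 0, 1:]) < 2" using degree_mod_less_degree[of "[:1, 0, 1:]" Q]
    by (cases "Q mod [:1, 0, 1:] = 0") (auto simp: mod_eq_0_iff_dvd numeral_2_eq_2)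
  then show ?thesis
    by (intro poly_eqI) (auto simp: coeff_pCons coeff_eq_0 split: nat.splits)
qed

section \<open>The L2 closure of the polynomials and its bounded multipliers\<close>

locale poly_moments =
  fixes M :: "real measure"
  assumes sets_M [measurable_cong]: "sets M = sets borel"
    and integrable_poly: "\<And>Q. integrable M (poly Q)"
begin

lemma space_M [simp]: "space M = UNIV"
  using sets_eq_imp_space_eq[OF sets_M] by simp

lemma poly_meas [measurable]: "poly (Q :: real poly) \<in> borel_measurable M"
  using integrable_poly by (rule borel_measurable_integrable)

definition L2 :: "(real \<Rightarrow> real) \<Rightarrow> bool" where
  "L2 f \<longleftrightarrow> f \<in> borel_measurable M \<and> integrable M (\<lambda>x. (f x)\<^sup>2)"

text \<open>Distances stay squared, with \<open>sum_power2_le\<close> in place of the triangle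
  inequality; hence the \<open>e / 4\<close> in later proofs. The conjunct \<open>L2 f\<close> keeps
  the integral from being the default 0 of a non-integrable function.\<close>

definition poly_closure :: "(real \<Rightarrow> real) \<Rightarrow> bool" where
  "poly_closure f \<longleftrightarrow> L2 f \<and> (\<forall>e>0. \<exists>Q. (LINT x|M. (f x - poly Q x)\<^sup>2) < e)"

lemma L2_bound:
  assumes [measurable]: "f \<in> borel_measurable M" and "L2 g" and le: "\<And>x. \<bar>f x\<bar> \<le> C * \<bar>g x\<bar>"
  shows "L2 f"
proof -
  have "integrable M (\<lambda>x. C\<^sup>2 * (g x)\<^sup>2)" using \<open>L2 g\<close> by (auto simp: L2_def)
  then have "integrable M (\<lambda>x. (f x)\<^sup>2)"
  proof (rule Bochner_Integration.integrable_bound)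
    have "(f x)\<^sup>2 \<le> C\<^sup>2 * (g x)\<^sup>2" for x
      using power_mono[OF le[of x], of 2] by (simp add: power_mult_distrib)
    then show "AE x in M. norm ((f x)\<^sup>2) \<le> norm (C\<^sup>2 * (g x)\<^sup>2)" by simp
  qed simp
  then show ?thesis by (simp add: L2_def)
qed

lemma L2_add: assumes "L2 f" "L2 g" shows "L2 (\<lambda>x. f x + g x)"
proof -
  have [measurable]: "f \<in> borel_measurable M" "g \<in> borel_measurable M" using assms by (auto simp: L2_def)
  have "integrable M (\<lambda>x. 2 * (f x)\<^sup>2 + 2 * (g x)\<^sup>2)" using assms by (auto simp: L2_def)
  then have "integrable M (\<lambda>x. (f x + g x)\<^sup>2)"
    by (rule Bochner_Integration.integrable_bound) (use sum_power2_le in \<open>auto\<close>)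
  then show ?thesis by (simp add: L2_def)
qed

lemma L2_scale: "L2 f \<Longrightarrow> L2 (\<lambda>x. c * f x)"
  by (rule L2_bound[of _ f "\<bar>c\<bar>"]) (auto simp: L2_def abs_mult)

lemma L2_diff: "L2 f \<Longrightarrow> L2 g \<Longrightarrow> L2 (\<lambda>x. f x - g x)"
  using L2_add[of f "\<lambda>x. - 1 * g x"] L2_scale[of g "-1"] by simp

lemma L2_poly: "L2 (poly Q)"
  using integrable_poly[of "Q\<^sup>2"] by (simp add: L2_def poly_power[abs_def])

lemma integral_diff_square_le:
  assumes "L2 f" "L2 g" "L2 h"
  shows "(LINT x|M. (f x - h x)\<^sup>2) \<le> 2 * (LINT x|M. (f x - g x)\<^sup>2) + 2 * (LINT x|M. (g x - h x)\<^sup>2)"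
proof -
  have i: "integrable M (\<lambda>x. (f x - h x)\<^sup>2)" "integrable M (\<lambda>x. (f x - g x)\<^sup>2)" "integrable M (\<lambda>x. (g x - h x)\<^sup>2)"
    using L2_diff assms by (auto simp: L2_def)
  have "(LINT x|M. (f x - h x)\<^sup>2) \<le> (LINT x|M. 2 * (f x - g x)\<^sup>2 + 2 * (g x - h x)\<^sup>2)"
    using i sum_power2_le[of "f x - g x" "g x - h x" for x] by (intro integral_mono) auto
  then show ?thesis using i by simp
qed

lemma poly_closureI:
  assumes "L2 f" "\<And>e. e > 0 \<Longrightarrow> \<exists>g. poly_closure g \<and> (LINT x|M. (f x - g x)\<^sup>2) < e"
  shows "poly_closure f"
  unfolding poly_closure_def
proof (intro conjI allI impI)
  fix e :: real assume e: "e > 0"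
  obtain g where g: "poly_closure g" "(LINT x|M. (f x - g x)\<^sup>2) < e / 4" using assms(2)[of "e/4"] e by auto
  obtain Q where Q: "(LINT x|M. (g x - poly Q x)\<^sup>2) < e / 4"
    using g(1) e unfolding poly_closure_def by (meson divide_pos_pos zero_less_numeral)
  have "(LINT x|M. (f x - poly Q x)\<^sup>2) < e"
    using integral_diff_square_le[of f g "poly Q"] assms(1) g Q L2_poly by (auto simp: poly_closure_def)
  then show "\<exists>Q. (LINT x|M. (f x - poly Q x)\<^sup>2) < e" by blast
qed fact

lemma poly_closure_poly: "poly_closure (poly Q)"
  unfolding poly_closure_def using L2_poly by (auto intro: exI[of _ Q])

lemma poly_closure_scale: assumes "poly_closure f" shows "poly_closure (\<lambda>x. c * f x)"
proof (cases "c = 0")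
  case True
  then show ?thesis using poly_closure_poly[of 0] by (simp add: poly_0[abs_def])
next
  case False
  show ?thesis
  unfolding poly_closure_def
  proof (intro conjI allI impI)
    show "L2 (\<lambda>x. c * f x)" using assms L2_scale by (auto simp: poly_closure_def)
    fix e :: real assume e: "e > 0"
    then obtain Q where Q: "(LINT x|M. (f x - poly Q x)\<^sup>2) < e / c\<^sup>2"
      using assms False unfolding poly_closure_def by (meson divide_pos_pos zero_less_power2)
    have "(LINT x|M. (c * f x - poly (smult c Q) x)\<^sup>2) = c\<^sup>2 * (LINT x|M. (f x - poly Q x)\<^sup>2)"
      by (simp add: power_mult_distrib flip: right_diff_distrib)
    also have "\<dots> < e" using Q False by (simp add: field_simps)
    finally show "\<exists>Q. (LINT x|M. (c * f x - poly Q x)\<^sup>2) < e" by blast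
  qed
qed

lemma poly_closure_add: assumes f: "poly_closure f" and g: "poly_closure g"
  shows "poly_closure (\<lambda>x. f x + g x)"
  unfolding poly_closure_def
proof (intro conjI allI impI)
  show "L2 (\<lambda>x. f x + g x)" using assms L2_add by (auto simp: poly_closure_def)
  fix e :: real assume e: "e > 0"
  obtain P Q where P: "(LINT x|M. (f x - poly P x)\<^sup>2) < e / 4" and Q: "(LINT x|M. (g x - poly Q x)\<^sup>2) < e / 4"
    using f g e unfolding poly_closure_def by (meson divide_pos_pos zero_less_numeral)
  have i: "integrable M (\<lambda>x. (f x - poly P x)\<^sup>2)" "integrable M (\<lambda>x. (g x - poly Q x)\<^sup>2)"
     "integrable M (\<lambda>x. ((f x - poly P x) + (g x - poly Q x))\<^sup>2)"
    using L2_diff[of f "poly P"] L2_diff[of g "poly Q"] L2_add[of "\<lambda>x. f x - poly P x" "\<lambda>x. g x - poly Q x"] f g L2_poly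
    by (auto simp: L2_def poly_closure_def)
  have "(LINT x|M. (f x + g x - poly (P + Q) x)\<^sup>2) = (LINT x|M. ((f x - poly P x) + (g x - poly Q x))\<^sup>2)"
    by (simp add: algebra_simps)
  also have "\<dots> \<le> (LINT x|M. 2 * (f x - poly P x)\<^sup>2 + 2 * (g x - poly Q x)\<^sup>2)"
    using i sum_power2_le by (intro integral_mono) auto
  also have "\<dots> < e" using i P Q by simp
  finally show "\<exists>Q. (LINT x|M. (f x + g x - poly Q x)\<^sup>2) < e" by blast
qed

lemma poly_closure_sum:
  "(\<And>i. i \<in> A \<Longrightarrow> poly_closure (f i)) \<Longrightarrow> poly_closure (\<lambda>x. \<Sum>i\<in>A. f i x)"
  using poly_closure_poly[of 0, unfolded poly_0[abs_def]]
  by (induction A rule: infinite_finite_induct) (auto intro: poly_closure_add)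

lemma poly_closure_dominated:
  assumes s: "\<And>n. poly_closure (s n)" and lim: "\<And>x. (\<lambda>n. s n x) \<longlonglongrightarrow> f x"
    and h: "L2 h" and le: "\<And>n x. \<bar>s n x\<bar> \<le> h x"
  shows "poly_closure f"
proof (rule poly_closureI)
  have [measurable]: "s n \<in> borel_measurable M" for n using s by (auto simp: poly_closure_def L2_def)
  have [measurable]: "f \<in> borel_measurable M"
    by (rule borel_measurable_LIMSEQ_real[of _ s]) (use lim in auto)
  have fh: "\<bar>f x\<bar> \<le> h x" for x
    by (rule LIMSEQ_le_const2[OF tendsto_rabs[OF lim]]) (use le in auto)
  show "L2 f" using h order_trans[OF fh abs_ge_self] by (intro L2_bound[of f h 1]) auto
  have "(\<lambda>n. LINT x|M. (f x - s n x)\<^sup>2) \<longlonglongrightarrow> (LINT x|M. 0)"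
  proof (rule integral_dominated_convergence[where w = "\<lambda>x. 4 * (h x)\<^sup>2"])
    show "integrable M (\<lambda>x. 4 * (h x)\<^sup>2)" using h by (auto simp: L2_def)
    show "AE x in M. (\<lambda>n. (f x - s n x)\<^sup>2) \<longlonglongrightarrow> 0"
    proof (rule AE_I2)
      fix x
      have "(\<lambda>n. (f x - s n x)\<^sup>2) \<longlonglongrightarrow> (f x - f x)\<^sup>2" by (intro tendsto_intros lim)
      then show "(\<lambda>n. (f x - s n x)\<^sup>2) \<longlonglongrightarrow> 0" by simp
    qed
    show "AE x in M. norm ((f x - s n x)\<^sup>2) \<le> 4 * (h x)\<^sup>2" for n
    proof (rule AE_I2)
      fix x
      have "\<bar>f x - s n x\<bar> \<le> 2 * h x" using fh[of x] le[of n x] by linarith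
      then have "\<bar>f x - s n x\<bar>\<^sup>2 \<le> (2 * h x)\<^sup>2" by (intro power_mono) auto
      then show "norm ((f x - s n x)\<^sup>2) \<le> 4 * (h x)\<^sup>2" by (simp add: power_mult_distrib)
    qed
  qed simp_all
  then have to0: "(\<lambda>n. LINT x|M. (f x - s n x)\<^sup>2) \<longlonglongrightarrow> 0" by simp
  fix e :: real assume "e > 0"
  then have "\<forall>\<^sub>F n in sequentially. (LINT x|M. (f x - s n x)\<^sup>2) < e"
    by (rule order_tendstoD(2)[OF to0])
  then obtain n where "(LINT x|M. (f x - s n x)\<^sup>2) < e"
    using eventually_happens trivial_limit_sequentially by blast
  then show "\<exists>g. poly_closure g \<and> (LINT x|M. (f x - g x)\<^sup>2) < e"
    using s by blast
qed

text \<open>Multipliers form an algebra closed under uniformly bounded pointwise limits; boundedness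
  supplies the dominating function \<open>\<bar>B\<bar> * \<bar>f\<bar>\<close> for such
  limits.\<close>

definition multiplier :: "(real \<Rightarrow> real) \<Rightarrow> bool" where
  "multiplier g \<longleftrightarrow> g \<in> borel_measurable M \<and> (\<exists>B. \<forall>x. \<bar>g x\<bar> \<le> B) \<and>
     (\<forall>f. poly_closure f \<longrightarrow> poly_closure (\<lambda>x. g x * f x))"

lemma multiplier_const: "multiplier (\<lambda>x. c)"
  unfolding multiplier_def using poly_closure_scale by auto

lemma multiplier_add: assumes "multiplier f" "multiplier g" shows "multiplier (\<lambda>x. f x + g x)"
proof -
  obtain B C where "\<And>x. \<bar>f x\<bar> \<le> B" "\<And>x. \<bar>g x\<bar> \<le> C" using assms by (auto simp: multiplier_def)
  then have "\<bar>f x + g x\<bar> \<le> B + C" for x by (meson abs_triangle_ineq add_mono order_trans)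
  then show ?thesis using assms unfolding multiplier_def by (auto simp: distrib_right intro!: poly_closure_add)
qed

lemma multiplier_mult: assumes "multiplier f" "multiplier g" shows "multiplier (\<lambda>x. f x * g x)"
proof -
  obtain B C where B: "\<And>x. \<bar>f x\<bar> \<le> B" "\<And>x. \<bar>g x\<bar> \<le> C" using assms by (auto simp: multiplier_def)
  then have "\<bar>f x * g x\<bar> \<le> B * C" for x unfolding abs_mult by (meson abs_ge_zero mult_mono order_trans)
  then show ?thesis using assms unfolding multiplier_def by (auto simp: mult.assoc)
qed

lemma multiplier_diff: "multiplier f \<Longrightarrow> multiplier g \<Longrightarrow> multiplier (\<lambda>x. f x - g x)"
  using multiplier_add[of f "\<lambda>x. - 1 * g x"] multiplier_mult[OF multiplier_const, of g "-1"] by simp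

lemma multiplier_power: "multiplier f \<Longrightarrow> multiplier (\<lambda>x. f x ^ n)"
  by (induction n) (auto intro: multiplier_const multiplier_mult)

lemma multiplier_limit:
  assumes s: "\<And>n. multiplier (s n)" and lim: "\<And>x. (\<lambda>n. s n x) \<longlonglongrightarrow> g x"
    and B: "\<And>n x. \<bar>s n x\<bar> \<le> B"
  shows "multiplier g"
  unfolding multiplier_def
proof (intro conjI allI impI exI[of _ B])
  have [measurable]: "s n \<in> borel_measurable M" for n using s by (auto simp: multiplier_def)
  show "g \<in> borel_measurable M"
    by (rule borel_measurable_LIMSEQ_real[of _ s]) (use lim in auto)
  show "\<bar>g x\<bar> \<le> B" for x
    by (rule LIMSEQ_le_const2[OF tendsto_rabs[OF lim]]) (use B in auto)
  fix f assume f: "poly_closure f"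
  have f': "L2 (\<lambda>x. \<bar>B\<bar> * \<bar>f x\<bar>)" using f
    by (intro L2_scale) (auto simp: poly_closure_def L2_def)
  show "poly_closure (\<lambda>x. g x * f x)"
  proof (rule poly_closure_dominated[OF _ _ f'])
    show "poly_closure (\<lambda>x. s n x * f x)" for n using s f by (auto simp: multiplier_def)
    show "(\<lambda>n. s n x * f x) \<longlonglongrightarrow> g x * f x" for x by (intro tendsto_intros lim)
    show "\<bar>s n x * f x\<bar> \<le> \<bar>B\<bar> * \<bar>f x\<bar>" for n x
      unfolding abs_mult using B[of n x] by (intro mult_right_mono) auto
  qed
qed

text \<open>Multiplication by \<open>g\<close> is an L2 contraction, so it carries polynomial
  approximations of \<open>f\<close> to approximations of \<open>g * f\<close>; only polynomials
  need checking.\<close>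

lemma multiplierI_bounded:
  assumes [measurable]: "g \<in> borel_measurable M" and g: "\<And>x. \<bar>g x\<bar> \<le> 1"
    and P: "\<And>Q. poly_closure (\<lambda>x. g x * poly Q x)"
  shows "multiplier g"
  unfolding multiplier_def
proof (intro conjI allI impI)
  show "\<exists>B. \<forall>x. \<bar>g x\<bar> \<le> B" using g by blast
  fix f assume f: "poly_closure f"
  then have fL2: "L2 f" and [measurable]: "f \<in> borel_measurable M" by (auto simp: poly_closure_def L2_def)
  show "poly_closure (\<lambda>x. g x * f x)"
  proof (rule poly_closureI)
    show "L2 (\<lambda>x. g x * f x)"
      by (rule L2_bound[OF _ fL2, of _ 1]) (auto simp: abs_mult intro!: mult_left_le_one_le g)
    fix e :: real assume "e > 0"
    then obtain Q where Q: "(LINT x|M. (f x - poly Q x)\<^sup>2) < e" using f by (auto simp: poly_closure_def)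
    have fQ: "L2 (\<lambda>x. f x - poly Q x)" using fL2 L2_poly by (rule L2_diff)
    have gfQ: "L2 (\<lambda>x. g x * f x - g x * poly Q x)"
      by (rule L2_bound[OF _ fQ, of _ 1]) (auto simp: abs_mult intro!: mult_left_le_one_le g simp flip: right_diff_distrib)
    have "(LINT x|M. (g x * f x - g x * poly Q x)\<^sup>2) \<le> (LINT x|M. (f x - poly Q x)\<^sup>2)"
    proof (rule integral_mono)
      show "(g x * f x - g x * poly Q x)\<^sup>2 \<le> (f x - poly Q x)\<^sup>2" for x
        unfolding right_diff_distrib[symmetric] power_mult_distrib
        using power_mono[OF g[of x], of 2] by (intro mult_left_le_one_le) auto
    qed (use fQ gfQ in \<open>auto simp: L2_def\<close>)
    then show "\<exists>h. poly_closure h \<and> (LINT x|M. (g x * f x - h x)\<^sup>2) < e"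
      using Q P[of Q] by (intro exI[of _ "\<lambda>x. g x * poly Q x"]) auto
  qed
qed fact

lemma multiplier_sgn: assumes g: "multiplier g" shows "multiplier (\<lambda>x. sgn (g x))"
proof -
  obtain B0 where B0: "\<And>x. \<bar>g x\<bar> \<le> B0" using g by (auto simp: multiplier_def)
  define B where "B = max B0 1"
  have B: "B > 0" "\<bar>g x\<bar> \<le> B" for x using B0[of x] by (auto simp: B_def)
  define h where "h = (\<lambda>x. 1 / B * g x)"
  have h: "multiplier h" unfolding h_def by (intro multiplier_mult multiplier_const g)
  have h1: "\<bar>h x\<bar> \<le> 1" for x using B by (simp add: h_def abs_mult)
  have "multiplier (\<lambda>x. sgn (h x))"
  proof (rule multiplier_limit)
    show "multiplier (\<lambda>x. sgn_iter n (h x))" for n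
    proof (induction n)
      case (Suc n)
      have "multiplier (\<lambda>x. 1 / 2 * (3 * sgn_iter n (h x) - sgn_iter n (h x) ^ 3))"
        by (intro multiplier_mult multiplier_const multiplier_diff multiplier_power Suc)
      then show ?case by simp
    qed (simp add: h)
    show "(\<lambda>n. sgn_iter n (h x)) \<longlonglongrightarrow> sgn (h x)" for x by (rule sgn_iter_tendsto[OF h1])
    show "\<bar>sgn_iter n (h x)\<bar> \<le> 1" for n x by (rule abs_sgn_iter_le[OF h1])
  qed
  then show ?thesis using B(1) by (simp add: h_def sgn_mult)
qed

lemma poly_dense_L2:
  assumes u: "poly_closure (\<lambda>x. 1 / (1 + x\<^sup>2))" and v: "poly_closure (\<lambda>x. x / (1 + x\<^sup>2))"
    and f: "L2 f"
  shows "poly_closure f"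
proof -
  have pos: "1 + x\<^sup>2 > 0" for x :: real by (simp add: add_pos_nonneg)
  \<comment> \<open>Division with remainder by \<open>1 + x^2\<close> leaves a polynomial plus a
    combination of the two assumed functions.\<close>
  have uP: "poly_closure (\<lambda>x. poly Q x / (1 + x\<^sup>2))" for Q
  proof -
    define r where "r = Q mod [:1, 0, 1:]"
    define S where "S = Q div [:1, 0, 1:]"
    have r: "r = [:coeff r 0, coeff r 1:]" unfolding r_def by (rule mod_one_plus_square)
    have "poly Q x / (1 + x\<^sup>2) = poly S x + (coeff r 0 * (1 / (1 + x\<^sup>2)) + coeff r 1 * (x / (1 + x\<^sup>2)))" for x
    proof -
      have "poly Q x = poly (S * [:1, 0, 1:] + r) x" unfolding S_def r_def by (simp only: div_mult_mod_eq)
      also have "\<dots> = poly S x * (1 + x\<^sup>2) + (coeff r 0 + coeff r 1 * x)"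
        by (subst r) (simp add: power2_eq_square algebra_simps)
      finally show ?thesis using pos[of x] by (simp add: add_divide_distrib)
    qed
    then show ?thesis by (simp only:) (intro poly_closure_add poly_closure_scale poly_closure_poly u v)
  qed
  have mu: "multiplier (\<lambda>x. 1 / (1 + x\<^sup>2))"
    by (rule multiplierI_bounded) (use uP pos in \<open>auto simp: divide_le_eq\<close>)
  have mv: "multiplier (\<lambda>x. x / (1 + x\<^sup>2))"
  proof (rule multiplierI_bounded)
    show "\<bar>x / (1 + x\<^sup>2)\<bar> \<le> 1" for x :: real
      using pos[of x] sum_squares_bound[of "\<bar>x\<bar>" 1] by (simp add: abs_divide divide_le_eq power2_eq_square)
    show "poly_closure (\<lambda>x. x / (1 + x\<^sup>2) * poly Q x)" for Q
      using uP[of "pCons 0 Q"] by simp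
  qed simp
  have ray: "multiplier (indicator {c<..})" for c :: real
  proof -
    have "multiplier (\<lambda>x. sgn (x / (1 + x\<^sup>2) - c * (1 / (1 + x\<^sup>2))))"
      by (intro multiplier_sgn multiplier_diff multiplier_mult multiplier_const mu mv)
    also have "(\<lambda>x. sgn (x / (1 + x\<^sup>2) - c * (1 / (1 + x\<^sup>2)))) = (\<lambda>x. sgn (x - c))"
    proof
      fix x :: real
      have "x / (1 + x\<^sup>2) - c * (1 / (1 + x\<^sup>2)) = (x - c) / (1 + x\<^sup>2)" by (simp add: diff_divide_distrib)
      then show "sgn (x / (1 + x\<^sup>2) - c * (1 / (1 + x\<^sup>2))) = sgn (x - c)"
        using pos[of x] by (simp add: sgn_divide)
    qed
    finally have s: "multiplier (\<lambda>x. sgn (x - c))" .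
    \<comment> \<open>\<open>s * (s + 1) / 2\<close> is 1 at \<open>s = 1\<close> and 0 at
      \<open>s = 0\<close> and \<open>s = -1\<close>.\<close>
    have "multiplier (\<lambda>x. 1 / 2 * (sgn (x - c) * (sgn (x - c) + 1)))"
      by (intro multiplier_add multiplier_mult multiplier_const s)
    also have "(\<lambda>x. 1 / 2 * (sgn (x - c) * (sgn (x - c) + 1))) = indicator {c<..}"
      by (auto simp: sgn_if indicator_def fun_eq_iff)
    finally show ?thesis .
  qed
  have ind: "multiplier (indicator A)" if A: "A \<in> sets borel" for A
  proof -
    have "A \<in> sigma_sets UNIV (range greaterThan)"
      using A by (simp add: borel_Ioi)
    then show ?thesis
    proof induction
      case (Basic A)
      then show ?case using ray by auto
    next
      case Empty
      then show ?case using multiplier_const[of 0] by (simp add: indicator_def)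
    next
      case (Compl A)
      have "multiplier (\<lambda>x. 1 - indicator A x)" by (intro multiplier_diff multiplier_const Compl)
      also have "(\<lambda>x. 1 - indicator A x :: real) = indicator (UNIV - A)" by (auto simp: indicator_def)
      finally show ?case .
    next
      case (Union A)
      have fin: "multiplier (indicator (\<Union>i<n. A i))" for n
      proof (induction n)
        case 0
        then show ?case using multiplier_const[of 0] by (simp add: indicator_def)
      next
        case (Suc n)
        \<comment> \<open>The sets need not be disjoint, so the union is formed through products of
          complements.\<close>
        have "multiplier (\<lambda>x. 1 - (1 - indicator (\<Union>i<n. A i) x) * (1 - indicator (A n) x))"
          by (intro multiplier_diff multiplier_mult multiplier_const Suc Union)
        also have "(\<lambda>x. 1 - (1 - indicator (\<Union>i<n. A i) x) * (1 - indicator (A n) x)) =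
            (indicator (\<Union>i<Suc n. A i) :: real \<Rightarrow> real)"
          by (auto simp: indicator_def fun_eq_iff lessThan_Suc)
        finally show ?case .
      qed
      show ?case
      proof (rule multiplier_limit[OF fin])
        show "(\<lambda>n. indicator (\<Union>i<n. A i) x) \<longlonglongrightarrow> (indicator (\<Union>i. A i) x :: real)" for x
          by (rule LIMSEQ_indicator_UN)
        show "\<bar>indicator (\<Union>i<n. A i) x :: real\<bar> \<le> 1" for n x by (simp add: indicator_def)
      qed
    qed
  qed
  have simple: "poly_closure g" if g: "simple_function M g" for g
  proof -
    \<comment> \<open>Writing each indicator as a multiplier applied to the constant polynomial 1
      places it in the closure.\<close>
    have "poly_closure (\<lambda>x. \<Sum>y\<in>range g. y * (indicator (g -` {y}) x * poly 1 x))"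
    proof (intro poly_closure_sum poly_closure_scale)
      fix y
      have "g -` {y} \<in> sets borel"
        using simple_functionD(2)[OF g, of "{y}"] sets_M by simp
      then show "poly_closure (\<lambda>x. indicator (g -` {y}) x * poly 1 x)"
        using ind poly_closure_poly unfolding multiplier_def by blast
    qed
    also have "(\<lambda>x. \<Sum>y\<in>range g. y * (indicator (g -` {y}) x * poly 1 x)) = g"
    proof
      fix x
      have "finite (range g)" using simple_functionD(1)[OF g] by simp
      then show "(\<Sum>y\<in>range g. y * (indicator (g -` {y}) x * poly 1 x)) = g x"
        by (subst sum.remove[of _ "g x"]) (auto simp: indicator_def intro!: sum.neutral)
    qed
    finally show ?thesis .
  qed
  have [measurable]: "f \<in> borel_measurable M" using f by (simp add: L2_def)
  obtain F where F: "\<And>i. simple_function M (F i)" "\<And>x. (\<lambda>i. F i x) \<longlonglongrightarrow> f x" "\<And>i x. dist (F i x) 0 \<le> 2 * dist (f x) 0"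
    using borel_measurable_implies_sequence_metric[of f M 0] by auto
  have "L2 (\<lambda>x. 2 * \<bar>f x\<bar>)" using f by (intro L2_scale) (auto simp: L2_def)
  with simple[OF F(1)] F(2) show ?thesis
    by (rule poly_closure_dominated) (use F(3) in auto)
qed

end

text \<open>The remainder modulo \<open>1 + x^2\<close> is linear with real coefficients, which are
  the real and imaginary parts of its value at \<i>.\<close>

lemma dvd_one_plus_square:
  assumes "poly (cpoly R) \<i> = 0"
  shows "[:1, 0, 1:] dvd R"
proof -
  define r where "r = R mod [:1, 0, 1:]"
  have r: "r = [:coeff r 0, coeff r 1:]" unfolding r_def by (rule mod_one_plus_square)
  have "poly (cpoly R) \<i> = poly (cpoly (R div [:1, 0, 1:] * [:1, 0, 1:] + r)) \<i>"
    unfolding r_def by (simp only: div_mult_mod_eq)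
  also have "\<dots> = poly (cpoly r) \<i>"
    unfolding cpoly_add cpoly_mult by (simp add: map_poly_pCons)
  also have "\<dots> = Complex (coeff r 0) (coeff r 1)"
    by (subst r) (simp add: map_poly_pCons complex_eq_iff)
  finally have "r = 0" using assms by (subst r) (simp add: complex_eq_iff)
  then show ?thesis unfolding r_def by (simp add: mod_eq_0_iff_dvd)
qed

lemma poly_cpoly_smult_sum:
  "poly (cpoly (\<Sum>k\<in>A. smult (c k) (q k))) z = (\<Sum>k\<in>A. of_real (c k) * poly (cpoly (q k)) z)"
  by (induction A rule: infinite_finite_induct) (auto simp: cpoly_add cpoly_smult)

section \<open>The Christoffel-Darboux kernel at \<i>\<close>

context jacobi
begin

abbreviation value_i :: "nat \<Rightarrow> complex" where "value_i k \<equiv> poly (cpoly (p k)) \<i>"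

text \<open>Multiplying the recurrence at \<i> by the conjugate of \<open>value_i (Suc n)\<close>
  and taking imaginary parts adds exactly one squared modulus per step, because \<i> has imaginary
  part 1.\<close>

lemma christoffel_darboux_i:
  "a n * Im (value_i (Suc n) * cnj (value_i n)) = (\<Sum>k\<le>n. (cmod (value_i k))\<^sup>2)"
proof (induction n)
  case 0
  then show ?case by (simp add: cpoly_rec_0)
next
  case (Suc n)
  have eq: "of_real (a (Suc n)) * value_i (Suc (Suc n)) = \<i> * value_i (Suc n) - of_real (a n) * value_i n"
    by (simp add: cpoly_rec_Suc)
  have "of_real (a (Suc n)) * (value_i (Suc (Suc n)) * cnj (value_i (Suc n))) =
     (of_real (a (Suc n)) * value_i (Suc (Suc n))) * cnj (value_i (Suc n))" by (simp only: mult.assoc)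
  also have "\<dots> =
     \<i> * (value_i (Suc n) * cnj (value_i (Suc n))) - of_real (a n) * (value_i n * cnj (value_i (Suc n)))"
    unfolding eq by (simp only: left_diff_distrib mult.assoc)
  finally have "Im (of_real (a (Suc n)) * (value_i (Suc (Suc n)) * cnj (value_i (Suc n)))) =
     (cmod (value_i (Suc n)))\<^sup>2 - a n * Im (value_i n * cnj (value_i (Suc n)))"
    by (simp add: complex_mult_cnj cmod_power2)
  moreover have "Im (value_i n * cnj (value_i (Suc n))) = - Im (value_i (Suc n) * cnj (value_i n))"
    by simp
  moreover have "Im (of_real r * z) = r * Im z" for r z by simp
  ultimately show ?case using Suc by (simp del: complex_cnj_mult times_complex.sel)
qed

text \<open>Carleman's condition enters only here: this divergence makes the kernel at \<open>\<i>\<close> blow up, and the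
  error of approximating \<open>1 / (x - \<i>)\<close> by polynomials is the reciprocal of that kernel.\<close>
lemma not_summable_value_i:
  assumes "\<not> summable (\<lambda>n. 1 / a n)"
  shows "\<not> summable (\<lambda>n. (cmod (value_i n))\<^sup>2)"
proof
  assume s: "summable (\<lambda>n. (cmod (value_i n))\<^sup>2)"
  have "summable (\<lambda>n. (cmod (value_i n))\<^sup>2 + (cmod (value_i (Suc n)))\<^sup>2)"
    using summable_ignore_initial_segment[OF s, of 1] by (intro summable_add s) simp
  \<comment> \<open>The \<open>k = 0\<close> term of the kernel is 1, so Christoffel-Darboux bounds
    \<open>1 / a n\<close> by a product of consecutive moduli.\<close>
  moreover have "norm (1 / a n) \<le> (cmod (value_i n))\<^sup>2 + (cmod (value_i (Suc n)))\<^sup>2" for n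
  proof -
    have "1 \<le> (\<Sum>k\<le>n. (cmod (value_i k))\<^sup>2)"
      using sum_mono2[of "{..n}" "{0}" "\<lambda>k. (cmod (value_i k))\<^sup>2"] by simp
    also have "\<dots> \<le> a n * cmod (value_i (Suc n) * cnj (value_i n))"
      unfolding christoffel_darboux_i[symmetric] using a_pos[of n] abs_Im_le_cmod
      by (intro mult_left_mono order_trans[OF abs_ge_self abs_Im_le_cmod]) auto
    also have "\<dots> = a n * (cmod (value_i n) * cmod (value_i (Suc n)))" by (simp add: norm_mult)
    also have "\<dots> \<le> a n * ((cmod (value_i n))\<^sup>2 + (cmod (value_i (Suc n)))\<^sup>2)"
    proof -
      have "0 \<le> cmod (value_i n) * cmod (value_i (Suc n))" by simp
      then have "cmod (value_i n) * cmod (value_i (Suc n)) \<le> (cmod (value_i n))\<^sup>2 + (cmod (value_i (Suc n)))\<^sup>2"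
        using sum_squares_bound[of "cmod (value_i n)" "cmod (value_i (Suc n))"] by linarith
      then show ?thesis using a_pos[of n] by (intro mult_left_mono) auto
    qed
    finally show ?thesis using a_pos[of n] by (simp add: field_simps)
  qed
  ultimately have "summable (\<lambda>n. 1 / a n)" by (rule summable_comparison_test'[where N = 0])
  then show False using assms by simp
qed

end

locale jacobi_measure = jacobi + poly_moments +
  assumes orth: "(LINT x|M. poly (p i) x * poly (p j) x) = (if i = j then 1 else 0)"
begin

lemma integral_square_smult_sum:
  assumes "finite A"
  shows "(LINT x|M. (poly (\<Sum>k\<in>A. smult (c k) (p k)) x)\<^sup>2) = (\<Sum>k\<in>A. (c k)\<^sup>2)"
proof -
  have i: "integrable M (\<lambda>x. poly (p i) x * poly (p j) x)" for i j
    using integrable_poly[of "p i * p j"] by (simp add: poly_mult[abs_def])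
  have "(LINT x|M. (poly (\<Sum>k\<in>A. smult (c k) (p k)) x)\<^sup>2) =
        (LINT x|M. (\<Sum>i\<in>A. \<Sum>j\<in>A. c i * c j * (poly (p i) x * poly (p j) x)))"
    by (simp add: poly_sum power2_eq_square sum_product mult_ac)
  also have "\<dots> = (\<Sum>i\<in>A. \<Sum>j\<in>A. c i * c j * (LINT x|M. poly (p i) x * poly (p j) x))"
    by (simp add: i)
  also have "\<dots> = (\<Sum>i\<in>A. \<Sum>j\<in>A. if j = i then c i * c j else 0)"
    unfolding orth by (intro sum.cong) auto
  also have "\<dots> = (\<Sum>i\<in>A. (c i)\<^sup>2)"
    using assms by (intro sum.cong) (auto simp: power2_eq_square)
  finally show ?thesis .
qed

text \<open>With the kernel \<open>Q(x) = (\<Sum>k\<le>n. cnj (p k \<i>) * p k x)\<close> and \<open>K = Q \<i>\<close>, the function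
  \<open>(1 - Q(x) / K) / (x - \<i>)\<close> is a polynomial, and it approximates \<open>1 / (x - \<i>)\<close> with squared
  error at most \<open>1 / K\<close>; this is split into real and imaginary parts.\<close>
lemma resolvent_approx:
  fixes n :: nat
  defines "K \<equiv> (\<Sum>k\<le>n. (cmod (value_i k))\<^sup>2)"
  shows "\<exists>Q. (LINT x|M. (1 / (1 + x\<^sup>2) - poly Q x)\<^sup>2) \<le> 1 / K"
    and "\<exists>Q. (LINT x|M. (x / (1 + x\<^sup>2) - poly Q x)\<^sup>2) \<le> 1 / K"
proof -
  have pos: "1 + x\<^sup>2 > 0" for x :: real by (simp add: add_pos_nonneg)
  have K1: "K \<ge> 1" unfolding K_def
    using sum_mono2[of "{..n}" "{0}" "\<lambda>k. (cmod (value_i k))\<^sup>2"] by simp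
  \<comment> \<open>On the real line \<open>A + \<i> * B\<close> is the kernel \<open>Q\<close>; the
    minus sign in \<open>B\<close> comes from the conjugation.\<close>
  define A where "A = (\<Sum>k\<le>n. smult (Re (value_i k)) (p k))"
  define B where "B = (\<Sum>k\<le>n. smult (- Im (value_i k)) (p k))"
  have iA: "integrable M (\<lambda>x. (poly A x)\<^sup>2)" and iB: "integrable M (\<lambda>x. (poly B x)\<^sup>2)"
    using L2_poly by (auto simp: L2_def)
  have AB: "(LINT x|M. ((poly A x)\<^sup>2 + (poly B x)\<^sup>2) / K\<^sup>2) = 1 / K"
  proof -
    have "(LINT x|M. (poly A x)\<^sup>2 + (poly B x)\<^sup>2) = K"
    proof -
      have "(LINT x|M. (poly A x)\<^sup>2) = (\<Sum>k\<le>n. (Re (value_i k))\<^sup>2)"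
        unfolding A_def by (rule integral_square_smult_sum) simp
      moreover have "(LINT x|M. (poly B x)\<^sup>2) = (\<Sum>k\<le>n. (- Im (value_i k))\<^sup>2)"
        unfolding B_def by (rule integral_square_smult_sum) simp
      ultimately show ?thesis using iA iB by (simp add: K_def cmod_power2 sum.distrib)
    qed
    then show ?thesis using K1 by (simp add: power2_eq_square)
  qed
  have Qi: "poly (cpoly A) \<i> + \<i> * poly (cpoly B) \<i> = of_real K"
  proof -
    have "poly (cpoly A) \<i> + \<i> * poly (cpoly B) \<i> = (\<Sum>k\<le>n. cnj (value_i k) * value_i k)"
      unfolding A_def B_def poly_cpoly_smult_sum sum_distrib_left sum.distrib[symmetric]
      by (intro sum.cong refl) (simp add: complex_eq_iff algebra_simps)
    also have "\<dots> = of_real K" unfolding K_def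
      by (simp add: complex_norm_square mult.commute del: of_real_power)
    finally show ?thesis .
  qed
  \<comment> \<open>Treats both parts at once. Multiplying \<open>1 - Q / K\<close> by
    \<open>(x + \<i>) / (1 + x^2)\<close> gives the numerators \<open>R\<close>, up to the factor
    \<open>K\<close>; the errors \<open>E\<close> are the imaginary and real parts of
    \<open>(x + \<i>) * Q\<close>. The integral of \<open>\<bar>Q\<bar>^2\<close> is
    \<open>K\<close>, so dividing by \<open>K^2\<close> leaves \<open>1 / K\<close>.\<close>
  have main: "\<exists>Q. (LINT x|M. (h x / (1 + x\<^sup>2) - poly Q x)\<^sup>2) \<le> 1 / K"
    if h: "\<And>x. poly R x = K * h x - E x" and Ri: "poly (cpoly R) \<i> = 0"
      and E: "\<And>x. (E x)\<^sup>2 \<le> (1 + x\<^sup>2) * ((poly A x)\<^sup>2 + (poly B x)\<^sup>2)" for R h E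
  proof -
    obtain S where S: "R = [:1, 0, 1:] * S" using dvd_one_plus_square[OF Ri] by (elim dvdE)
    have hS: "h x / (1 + x\<^sup>2) - poly (smult (1 / K) S) x = E x / (K * (1 + x\<^sup>2))" for x
    proof -
      have "poly R x = (1 + x\<^sup>2) * poly S x" unfolding S by (simp add: power2_eq_square algebra_simps)
      then have "(1 + x\<^sup>2) * poly S x = K * h x - E x" using h by simp
      then have "poly S x = (K * h x - E x) / (1 + x\<^sup>2)" using pos[of x] by (simp add: field_simps)
      then show ?thesis using K1 pos[of x] by (simp add: field_simps)
    qed
    have "(LINT x|M. (h x / (1 + x\<^sup>2) - poly (smult (1 / K) S) x)\<^sup>2)
       \<le> (LINT x|M. ((poly A x)\<^sup>2 + (poly B x)\<^sup>2) / K\<^sup>2)"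
    proof (rule integral_mono')
      show "integrable M (\<lambda>x. ((poly A x)\<^sup>2 + (poly B x)\<^sup>2) / K\<^sup>2)" using iA iB by simp
      fix x
      show "(h x / (1 + x\<^sup>2) - poly (smult (1 / K) S) x)\<^sup>2 \<le> ((poly A x)\<^sup>2 + (poly B x)\<^sup>2) / K\<^sup>2"
      proof -
        have "(E x)\<^sup>2 \<le> (1 + x\<^sup>2) * ((poly A x)\<^sup>2 + (poly B x)\<^sup>2)" by (rule E)
        also have "\<dots> \<le> (1 + x\<^sup>2)\<^sup>2 * ((poly A x)\<^sup>2 + (poly B x)\<^sup>2)"
          by (intro mult_right_mono self_le_power) auto
        finally have "(E x)\<^sup>2 / (1 + x\<^sup>2)\<^sup>2 \<le> (poly A x)\<^sup>2 + (poly B x)\<^sup>2"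
          using pos[of x] by (simp add: pos_divide_le_eq mult.commute)
        then have "(E x)\<^sup>2 / (1 + x\<^sup>2)\<^sup>2 / K\<^sup>2 \<le> ((poly A x)\<^sup>2 + (poly B x)\<^sup>2) / K\<^sup>2"
          by (intro divide_right_mono) auto
        then show ?thesis unfolding hS by (simp add: power_divide power_mult_distrib mult.commute)
      qed
    qed auto
    then show ?thesis unfolding AB by blast
  qed
  have cs: "(s * x + t * y)\<^sup>2 \<le> (s\<^sup>2 + t\<^sup>2) * (x\<^sup>2 + (y::real)\<^sup>2)" for s t x y
    using zero_le_power2[of "s * y - t * x"] by (simp add: power2_eq_square algebra_simps)
  show "\<exists>Q. (LINT x|M. (1 / (1 + x\<^sup>2) - poly Q x)\<^sup>2) \<le> 1 / K"
  proof (rule main[of "[:K:] - A - pCons 0 B" _ "\<lambda>x. poly A x + x * poly B x"])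
    show "poly (cpoly ([:K:] - A - pCons 0 B)) \<i> = 0"
      unfolding cpoly_diff using Qi by (simp add: map_poly_pCons algebra_simps)
    show "(poly A x + x * poly B x)\<^sup>2 \<le> (1 + x\<^sup>2) * ((poly A x)\<^sup>2 + (poly B x)\<^sup>2)" for x
      using cs[of 1 "poly A x" x "poly B x"] by simp
  qed simp
  show "\<exists>Q. (LINT x|M. (x / (1 + x\<^sup>2) - poly Q x)\<^sup>2) \<le> 1 / K"
  proof (rule main[of "pCons 0 ([:K:] - A) + B" _ "\<lambda>x. x * poly A x - poly B x"])
    have "poly (cpoly (pCons 0 ([:K:] - A) + B)) \<i> = \<i> * (of_real K - (poly (cpoly A) \<i> + \<i> * poly (cpoly B) \<i>))"
      by (simp add: cpoly_add cpoly_diff map_poly_pCons algebra_simps)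
    then show "poly (cpoly (pCons 0 ([:K:] - A) + B)) \<i> = 0" unfolding Qi by simp
    show "(x * poly A x - poly B x)\<^sup>2 \<le> (1 + x\<^sup>2) * ((poly A x)\<^sup>2 + (poly B x)\<^sup>2)" for x
      using cs[of x "poly A x" "- 1" "poly B x"] by (simp add: add.commute)
  qed (simp add: algebra_simps)
qed

lemma poly_dense:
  assumes "\<not> summable (\<lambda>n. 1 / a n)" and "L2 f"
  shows "poly_closure f"
proof (rule poly_dense_L2)
  have pos: "1 + x\<^sup>2 > 0" for x :: real by (simp add: add_pos_nonneg)
  have K: "\<exists>n. 1 / (\<Sum>k\<le>n. (cmod (value_i k))\<^sup>2) < e" if "e > 0" for e
  proof (rule ccontr)
    assume "\<nexists>n. 1 / (\<Sum>k\<le>n. (cmod (value_i k))\<^sup>2) < e"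
    then have le: "1 / (\<Sum>k\<le>n. (cmod (value_i k))\<^sup>2) \<ge> e" for n by (simp add: not_less)
    have "(\<Sum>k\<le>n. (cmod (value_i k))\<^sup>2) \<le> 1 / e" for n
    proof -
      have "(\<Sum>k\<le>n. (cmod (value_i k))\<^sup>2) \<ge> 1"
        using sum_mono2[of "{..n}" "{0}" "\<lambda>k. (cmod (value_i k))\<^sup>2"] by simp
      then show ?thesis using le[of n] that by (simp add: field_simps)
    qed
    then have "summable (\<lambda>n. (cmod (value_i n))\<^sup>2)"
      by (intro bounded_imp_summable) auto
    then show False using not_summable_value_i assms(1) by blast
  qed
  have L2_1: "L2 (poly 1)" by (rule L2_poly)
  show "poly_closure (\<lambda>x. 1 / (1 + x\<^sup>2))"
    unfolding poly_closure_def
  proof (intro conjI allI impI)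
    show "L2 (\<lambda>x. 1 / (1 + x\<^sup>2))"
      by (rule L2_bound[OF _ L2_1, of _ 1]) (use pos in \<open>auto simp: divide_le_eq\<close>)
    show "\<exists>Q. (LINT x|M. (1 / (1 + x\<^sup>2) - poly Q x)\<^sup>2) < e" if "e > 0" for e
      using K[OF that] resolvent_approx(1) by (meson le_less_trans)
  qed
  show "poly_closure (\<lambda>x. x / (1 + x\<^sup>2))"
    unfolding poly_closure_def
  proof (intro conjI allI impI)
    have "\<bar>x / (1 + x\<^sup>2)\<bar> \<le> 1" for x :: real
      using pos[of x] sum_squares_bound[of "\<bar>x\<bar>" 1] by (simp add: abs_divide divide_le_eq power2_eq_square)
    then show "L2 (\<lambda>x. x / (1 + x\<^sup>2))"
      by (intro L2_bound[OF _ L2_1, of _ 1]) auto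
    show "\<exists>Q. (LINT x|M. (x / (1 + x\<^sup>2) - poly Q x)\<^sup>2) < e" if "e > 0" for e
      using K[OF that] resolvent_approx(2) by (meson le_less_trans)
  qed
qed fact

end

section \<open>Pairwise geometric Jacobi coefficients\<close>

lemma continuous_Icc_bounded:
  fixes f :: "real \<Rightarrow> real"
  assumes "continuous_on {l..u} f"
  shows "\<exists>B. \<forall>x\<in>{l..u}. f x \<le> B"
proof -
  have "bounded (f ` {l..u})"
    using assms by (intro compact_imp_bounded compact_continuous_image) auto
  then obtain B where "\<forall>x\<in>{l..u}. \<bar>f x\<bar> \<le> B" unfolding bounded_iff by auto
  then show ?thesis by (meson abs_le_D1)
qed

text \<open>\<open>ratio\<close> spans two indices and gives
  \<open>a (2 k + 1) \<le> C * a (2 k)\<close>, which is what lets the diagonal of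
  \<open>F k\<close> absorb its cross term.\<close>

locale paired_jacobi = jacobi +
  fixes C :: real
  assumes geom: "(a (2 * k + 1))\<^sup>2 = a (2 * k) * a (2 * Suc k)"
    and incr: "a (2 * k) \<le> a (2 * Suc k)"
    and ratio: "a (2 * Suc k) \<le> C * a (2 * k)"
    and lim_a: "filterlim (\<lambda>k. a (2 * k)) at_top sequentially"
begin

lemma C_ge_1: "C \<ge> 1"
proof -
  have "1 * a (2 * 0) \<le> C * a (2 * 0)" using incr[of 0] ratio[of 0] by linarith
  then show ?thesis using a_pos[of "2 * 0"] mult_right_le_imp_le by blast
qed

lemma a_even_mono: "i \<le> j \<Longrightarrow> a (2 * i) \<le> a (2 * j)"
  using incr lift_Suc_mono_le[of "\<lambda>k. a (2 * k)"] by blast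

definition F :: "nat \<Rightarrow> real \<Rightarrow> real" where
  "F k x = a (2 * k) * ((poly (p (2 * k)) x)\<^sup>2 + (poly (p (2 * k + 1)) x)\<^sup>2)
             - x * poly (p (2 * k)) x * poly (p (2 * k + 1)) x"

text \<open>\<open>F\<close> without its cross term. The increments of \<open>F\<close> are
  controllable, whereas \<open>G\<close> is what appears in the density and in the bound on the
  polynomials.\<close>

definition G :: "nat \<Rightarrow> real \<Rightarrow> real" where
  "G k x = a (2 * k) * ((poly (p (2 * k)) x)\<^sup>2 + (poly (p (2 * k + 1)) x)\<^sup>2)"

lemma W_even: "W (2 * k) x = 1 / (pi * G k x)"
  by (simp add: W_def G_def)

lemma G_pos: "G k x > 0"
  unfolding G_def using a_pos sum_squares_pos[of "2 * k" x] by simp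

text \<open>The recurrence expresses both \<open>F k\<close> and \<open>F (k + 1)\<close> as quadratic forms in the middle pair
  \<open>p (2 k + 1)\<close>, \<open>p (2 k + 2)\<close>. Since \<open>a (2 k + 1)\<close> is a geometric mean, they have
  the same diagonal coefficients.\<close>
lemma F_middle:
  defines "P \<equiv> \<lambda>k x. poly (p (2 * k + 1)) x" and "Q \<equiv> \<lambda>k x. poly (p (2 * Suc k)) x"
  shows "F k x = a (2 * k) * (P k x)\<^sup>2 + a (2 * Suc k) * (Q k x)\<^sup>2
            - a (2 * k + 1) / a (2 * k) * (x * P k x * Q k x)"
    and "F (Suc k) x = a (2 * k) * (P k x)\<^sup>2 + a (2 * Suc k) * (Q k x)\<^sup>2
            - a (2 * k + 1) / a (2 * Suc k) * (x * P k x * Q k x)"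
proof -
  define A m E where "A = a (2 * k)" and "m = a (2 * k + 1)" and "E = a (2 * Suc k)"
  define u v y z where "u = poly (p (2 * k)) x" and "v = poly (p (2 * k + 1)) x"
    and "y = poly (p (2 * Suc k)) x" and "z = poly (p (2 * Suc k + 1)) x"
  have nz: "A \<noteq> 0" "E \<noteq> 0" "m \<noteq> 0" by (auto simp: A_def E_def m_def)
  have g: "m * m = A * E" using geom[of k] by (simp add: A_def m_def E_def power2_eq_square)
  have y: "m * y = x * v - A * u"
    unfolding y_def v_def u_def A_def m_def using poly_rec_Suc[of "2 * k" x] by simp
  have z: "E * z = x * y - m * v"
    unfolding y_def v_def z_def E_def m_def using poly_rec_Suc[of "2 * k + 1" x] by simp
  \<comment> \<open>Scaled by \<open>A\<close>, the form contains \<open>u\<close> only through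
    \<open>A * u\<close>, which the recurrence replaces; \<open>m * m = A * E\<close> then produces
    the coefficient \<open>E\<close>.\<close>
  have "A * (A * (u\<^sup>2 + v\<^sup>2) - x * u * v) = A * (A * v\<^sup>2) + (A * u) * (A * u - x * v)"
    by (simp add: algebra_simps power2_eq_square)
  also have "A * u = x * v - m * y" using y by simp
  also have "A * (A * v\<^sup>2) + (x * v - m * y) * (x * v - m * y - x * v) =
     A * (A * v\<^sup>2) + m * m * y\<^sup>2 - m * (x * v * y)"
    by (simp add: algebra_simps power2_eq_square)
  also have "\<dots> = A * (A * v\<^sup>2 + E * y\<^sup>2 - m / A * (x * v * y))"
    using nz unfolding g by (simp add: algebra_simps)
  finally have 1: "A * (u\<^sup>2 + v\<^sup>2) - x * u * v = A * v\<^sup>2 + E * y\<^sup>2 - m / A * (x * v * y)"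
    using nz by simp
  have "E * (E * (y\<^sup>2 + z\<^sup>2) - x * y * z) = E * (E * y\<^sup>2) + (E * z) * (E * z - x * y)"
    by (simp add: algebra_simps power2_eq_square)
  also have "\<dots> = E * (E * y\<^sup>2) + m * m * v\<^sup>2 - m * (x * v * y)"
    unfolding z by (simp add: algebra_simps power2_eq_square)
  also have "\<dots> = E * (A * v\<^sup>2 + E * y\<^sup>2 - m / E * (x * v * y))"
    using nz unfolding g by (simp add: algebra_simps)
  finally have 2: "E * (y\<^sup>2 + z\<^sup>2) - x * y * z = A * v\<^sup>2 + E * y\<^sup>2 - m / E * (x * v * y)"
    using nz by simp
  show "F k x = a (2 * k) * (P k x)\<^sup>2 + a (2 * Suc k) * (Q k x)\<^sup>2
            - a (2 * k + 1) / a (2 * k) * (x * P k x * Q k x)"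
    using 1 unfolding F_def P_def Q_def A_def m_def E_def u_def v_def y_def .
  show "F (Suc k) x = a (2 * k) * (P k x)\<^sup>2 + a (2 * Suc k) * (Q k x)\<^sup>2
            - a (2 * k + 1) / a (2 * Suc k) * (x * P k x * Q k x)"
    using 2 unfolding F_def P_def Q_def A_def m_def E_def v_def y_def z_def .
qed

text \<open>The diagonals agree, so the increment is
  \<open>m * (1 / A - 1 / E) * (x * v * y)\<close>. For such \<open>x\<close> the cross term of
  \<open>F k\<close> is at most \<open>A * \<bar>v * y\<bar>\<close>, by AM-GM at most half of
  \<open>A * (v^2 + y^2)\<close>; what is left of the diagonal is positive and still dominates
  \<open>A * \<bar>v * y\<bar>\<close>.\<close>

lemma F_step:
  assumes x: "C * \<bar>x\<bar> \<le> a (2 * k)"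
  shows "F k x > 0"
    and "\<bar>F (Suc k) x - F k x\<bar> \<le> \<bar>x\<bar> * C * (1 / a (2 * k) - 1 / a (2 * Suc k)) * F k x"
proof -
  define A m E where "A = a (2 * k)" and "m = a (2 * k + 1)" and "E = a (2 * Suc k)"
  define v y where "v = poly (p (2 * k + 1)) x" and "y = poly (p (2 * Suc k)) x"
  have pos: "A > 0" "m > 0" "E > 0" using a_pos by (auto simp: A_def m_def E_def)
  have AE: "A \<le> E" "E \<le> C * A" using incr ratio by (auto simp: A_def E_def)
  have "m\<^sup>2 \<le> (C * A)\<^sup>2"
  proof -
    have "m\<^sup>2 = A * E" using geom by (simp add: A_def m_def E_def)
    also have "\<dots> \<le> (C * A) * (C * A)"
      using order_trans[OF AE] AE(2) pos by (intro mult_mono) auto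
    finally show ?thesis by (simp add: power2_eq_square)
  qed
  then have "m \<le> C * A" by (rule power2_le_imp_le) (use pos C_ge_1 in simp)
  then have mA: "m / A \<le> C" using pos by (simp add: pos_divide_le_eq)
  have Fk: "F k x = A * v\<^sup>2 + E * y\<^sup>2 - m / A * (x * v * y)"
    unfolding A_def m_def E_def v_def y_def by (rule F_middle)
  have FS: "F (Suc k) x = A * v\<^sup>2 + E * y\<^sup>2 - m / E * (x * v * y)"
    unfolding A_def m_def E_def v_def y_def by (rule F_middle)
  have cross: "m / A * (x * v * y) \<le> A * (\<bar>v\<bar> * \<bar>y\<bar>)"
  proof -
    have "x * v * y \<le> \<bar>x\<bar> * (\<bar>v\<bar> * \<bar>y\<bar>)"
      using abs_ge_self[of "x * v * y"] by (simp only: abs_mult mult.assoc)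
    then have "m / A * (x * v * y) \<le> m / A * (\<bar>x\<bar> * (\<bar>v\<bar> * \<bar>y\<bar>))"
      using pos by (intro mult_left_mono) auto
    also have "\<dots> \<le> C * (\<bar>x\<bar> * (\<bar>v\<bar> * \<bar>y\<bar>))" using mA by (intro mult_right_mono) auto
    also have "\<dots> = C * \<bar>x\<bar> * (\<bar>v\<bar> * \<bar>y\<bar>)" by simp
    also have "\<dots> \<le> A * (\<bar>v\<bar> * \<bar>y\<bar>)" using x by (intro mult_right_mono) (auto simp: A_def)
    finally show ?thesis .
  qed
  have amgm: "2 * (\<bar>v\<bar> * \<bar>y\<bar>) \<le> v\<^sup>2 + y\<^sup>2"
    using sum_squares_bound[of "\<bar>v\<bar>" "\<bar>y\<bar>"] by simp
  have Ey: "A * y\<^sup>2 \<le> E * y\<^sup>2" using AE by (intro mult_right_mono) auto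
  have lower: "A * (v\<^sup>2 + y\<^sup>2 - \<bar>v\<bar> * \<bar>y\<bar>) \<le> F k x"
    using cross Ey unfolding Fk by (simp add: algebra_simps)
  have "v\<^sup>2 + y\<^sup>2 > 0" using sum_squares_pos[of "2 * k + 1" x] by (simp add: v_def y_def)
  then have "A * (v\<^sup>2 + y\<^sup>2 - \<bar>v\<bar> * \<bar>y\<bar>) > 0" using amgm pos by (intro mult_pos_pos) auto
  then show Fpos: "F k x > 0" using lower by linarith
  have "A * (\<bar>v\<bar> * \<bar>y\<bar>) \<le> A * (v\<^sup>2 + y\<^sup>2 - \<bar>v\<bar> * \<bar>y\<bar>)"
    using amgm pos by (intro mult_left_mono) auto
  from order_trans[OF this lower] have vy: "\<bar>v\<bar> * \<bar>y\<bar> \<le> F k x / A" using pos by (simp add: pos_le_divide_eq mult.commute)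
  have d: "1 / A - 1 / E \<ge> 0" using AE pos by (simp add: frac_le)
  have "F (Suc k) x - F k x = m * (1 / A - 1 / E) * (x * v * y)"
    unfolding Fk FS by (simp add: algebra_simps)
  then have "\<bar>F (Suc k) x - F k x\<bar> = m * (1 / A - 1 / E) * \<bar>x\<bar> * (\<bar>v\<bar> * \<bar>y\<bar>)"
    using pos d by (simp add: abs_mult)
  also have "\<dots> \<le> m * (1 / A - 1 / E) * \<bar>x\<bar> * (F k x / A)"
    using vy pos d by (intro mult_left_mono) auto
  also have "\<dots> = (m / A) * (\<bar>x\<bar> * (1 / A - 1 / E) * F k x)" by simp
  also have "\<dots> \<le> C * (\<bar>x\<bar> * (1 / A - 1 / E) * F k x)"
    using mA d Fpos by (intro mult_right_mono) auto
  finally show "\<bar>F (Suc k) x - F k x\<bar> \<le> \<bar>x\<bar> * C * (1 / a (2 * k) - 1 / a (2 * Suc k)) * F k x"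
    by (simp add: A_def E_def mult_ac)
qed

text \<open>A bootstrap: while \<open>F j \<le> 2 * F k0\<close>, the increments telescope to at
  most \<open>2 * C * \<bar>x\<bar> * F k0 / a (2 * k0)\<close>. The factor 4 in the assumption
  makes this at most \<open>F k0 / 2\<close>, which renews the bound on \<open>F j\<close>.\<close>

lemma F_dist_le:
  assumes x: "4 * C * \<bar>x\<bar> \<le> a (2 * k0)" and k: "k0 \<le> k"
  shows "\<bar>F k x - F k0 x\<bar> \<le> 2 * C * \<bar>x\<bar> * F k0 x * (1 / a (2 * k0) - 1 / a (2 * k))"
    and "2 * C * \<bar>x\<bar> * F k0 x * (1 / a (2 * k0) - 1 / a (2 * k)) \<le> F k0 x / 2"
proof -
  have Cx: "C * \<bar>x\<bar> \<ge> 0" using C_ge_1 by simp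
  have x': "C * \<bar>x\<bar> \<le> a (2 * j)" if "k0 \<le> j" for j
    using x Cx a_even_mono[OF that] by linarith
  have Fpos: "F j x > 0" if "k0 \<le> j" for j using F_step(1)[OF x'[OF that]] .
  have half: "2 * C * \<bar>x\<bar> * F k0 x * (1 / a (2 * k0) - 1 / a (2 * j)) \<le> F k0 x / 2" if "k0 \<le> j" for j
  proof -
    have "2 * C * \<bar>x\<bar> * (1 / a (2 * k0) - 1 / a (2 * j)) \<le> 2 * C * \<bar>x\<bar> * (1 / a (2 * k0))"
      using Cx a_pos[of "2 * j"] by (intro mult_left_mono) (auto simp: less_imp_le)
    also have "\<dots> \<le> 1 / 2" using x a_pos[of "2 * k0"] by (simp add: field_simps)
    finally have "F k0 x * (2 * C * \<bar>x\<bar> * (1 / a (2 * k0) - 1 / a (2 * j))) \<le> F k0 x * (1 / 2)"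
      using Fpos[of k0] by (intro mult_left_mono) auto
    moreover have "F k0 x * (2 * C * \<bar>x\<bar> * (1 / a (2 * k0) - 1 / a (2 * j)))
        = 2 * C * \<bar>x\<bar> * F k0 x * (1 / a (2 * k0) - 1 / a (2 * j))" by (simp only: mult_ac)
    ultimately show ?thesis by linarith
  qed
  show "2 * C * \<bar>x\<bar> * F k0 x * (1 / a (2 * k0) - 1 / a (2 * k)) \<le> F k0 x / 2" by (rule half[OF k])
  show "\<bar>F k x - F k0 x\<bar> \<le> 2 * C * \<bar>x\<bar> * F k0 x * (1 / a (2 * k0) - 1 / a (2 * k))"
    using k
  proof (induction k rule: dec_induct)
    case base
    then show ?case by simp
  next
    case (step j)
    have d: "1 / a (2 * j) - 1 / a (2 * Suc j) \<ge> 0" using incr[of j] a_pos[of "2 * j"] by (simp add: frac_le)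
    have "\<bar>F j x - F k0 x\<bar> \<le> F k0 x / 2" using step.IH half[OF step.hyps(1)] by linarith
    then have "F j x \<le> 2 * F k0 x" using Fpos[of k0] by linarith
    then have "\<bar>x\<bar> * C * (1 / a (2 * j) - 1 / a (2 * Suc j)) * F j x
        \<le> \<bar>x\<bar> * C * (1 / a (2 * j) - 1 / a (2 * Suc j)) * (2 * F k0 x)"
      using d C_ge_1 by (intro mult_left_mono) auto
    then have "\<bar>F (Suc j) x - F j x\<bar> \<le> 2 * C * \<bar>x\<bar> * F k0 x * (1 / a (2 * j) - 1 / a (2 * Suc j))"
      using F_step(2)[OF x'[OF step.hyps(1)]] by (simp only: mult_ac)
    then have "\<bar>F (Suc j) x - F k0 x\<bar> \<le> 2 * C * \<bar>x\<bar> * F k0 x * (1 / a (2 * k0) - 1 / a (2 * j)) +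
        2 * C * \<bar>x\<bar> * F k0 x * (1 / a (2 * j) - 1 / a (2 * Suc j))" using step.IH by linarith
    also have "\<dots> = 2 * C * \<bar>x\<bar> * F k0 x * (1 / a (2 * k0) - 1 / a (2 * Suc j))"
      by (simp add: right_diff_distrib)
    finally show ?case .
  qed
qed

lemma F_comparable:
  assumes x: "4 * C * \<bar>x\<bar> \<le> a (2 * k0)" and k: "k0 \<le> k"
  shows "F k0 x > 0" "F k0 x / 2 \<le> F k x" "F k x \<le> 2 * F k0 x"
proof -
  have "C * \<bar>x\<bar> \<ge> 0" using C_ge_1 by simp
  then show "F k0 x > 0" using F_step(1)[of x k0] x by simp
  then show "F k0 x / 2 \<le> F k x" "F k x \<le> 2 * F k0 x" using F_dist_le[OF x k] by linarith+
qed

lemma ex_start: "\<exists>k0. 4 * C * R \<le> a (2 * k0)"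
  using lim_a unfolding filterlim_at_top eventually_sequentially by blast

lemma tendsto_inverse_a: "(\<lambda>k. 1 / a (2 * k)) \<longlonglongrightarrow> 0"
  using tendsto_inverse_0_at_top[OF lim_a] by (simp add: inverse_eq_divide)

text \<open>The increments are dominated by a constant times the telescoping series of
  \<open>1 / a (2 k)\<close>, which converges as \<open>a (2 k)\<close> tends to infinity.\<close>

lemma F_convergent: "convergent (\<lambda>k. F k x)"
proof -
  obtain k0 where k0: "4 * C * \<bar>x\<bar> \<le> a (2 * k0)" using ex_start by blast
  have Cx: "C * \<bar>x\<bar> \<ge> 0" using C_ge_1 by simp
  have "summable (\<lambda>k. 1 / a (2 * k) - 1 / a (2 * Suc k))"
    by (rule telescope_summable'[OF tendsto_inverse_a])
  then have "summable (\<lambda>k. 2 * C * \<bar>x\<bar> * F k0 x * (1 / a (2 * k) - 1 / a (2 * Suc k)))"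
    by (rule summable_mult)
  then have "summable (\<lambda>k. F (Suc k) x - F k x)"
  proof (rule summable_comparison_test'[where N = k0])
    fix k assume k: "k0 \<le> k"
    have d: "1 / a (2 * k) - 1 / a (2 * Suc k) \<ge> 0" using incr[of k] a_pos[of "2 * k"] by (simp add: frac_le)
    have "C * \<bar>x\<bar> \<le> a (2 * k)" using k0 Cx a_even_mono[OF k] by linarith
    from F_step(2)[OF this]
    have "\<bar>F (Suc k) x - F k x\<bar> \<le> \<bar>x\<bar> * C * (1 / a (2 * k) - 1 / a (2 * Suc k)) * F k x" .
    also have "\<dots> \<le> \<bar>x\<bar> * C * (1 / a (2 * k) - 1 / a (2 * Suc k)) * (2 * F k0 x)"
      using d C_ge_1 F_comparable[OF k0 k] by (intro mult_left_mono) auto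
    finally show "norm (F (Suc k) x - F k x) \<le> 2 * C * \<bar>x\<bar> * F k0 x * (1 / a (2 * k) - 1 / a (2 * Suc k))"
      by (simp only: mult_ac real_norm_def)
  qed
  from summable_LIMSEQ[OF this] have "(\<lambda>n. F n x - F 0 x) \<longlonglongrightarrow> (\<Sum>k. F (Suc k) x - F k x)"
    by (simp only: sum_lessThan_telescope[of "\<lambda>k. F k x"])
  then have "(\<lambda>n. (F n x - F 0 x) + F 0 x) \<longlonglongrightarrow> (\<Sum>k. F (Suc k) x - F k x) + F 0 x"
    by (intro tendsto_intros)
  then show ?thesis by (auto simp: convergent_def)
qed

section \<open>The limit of the forms and local bounds\<close>

definition F_lim :: "real \<Rightarrow> real" where "F_lim x = lim (\<lambda>k. F k x)"

lemma F_tendsto: "(\<lambda>k. F k x) \<longlonglongrightarrow> F_lim x"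
  using F_convergent unfolding F_lim_def by (simp add: convergent_LIMSEQ_iff)

lemma F_lim_pos: "F_lim x > 0"
proof -
  obtain k0 where k0: "4 * C * \<bar>x\<bar> \<le> a (2 * k0)" using ex_start by blast
  have "F k0 x / 2 \<le> F_lim x"
    by (rule LIMSEQ_le_const[OF F_tendsto]) (use F_comparable(2)[OF k0] in blast)
  then show ?thesis using F_comparable(1)[OF k0 order_refl] by linarith
qed

text \<open>AM-GM on the cross term. The relative error \<open>\<bar>x\<bar> / (2 * a (2 k))\<close>
  tends to 0, so \<open>F\<close> and \<open>G\<close> share their limit.\<close>

lemma F_G_le:
  assumes "\<bar>x\<bar> \<le> a (2 * k)"
  shows "\<bar>G k x - F k x\<bar> \<le> \<bar>x\<bar> / a (2 * k) * (G k x / 2)" "G k x \<le> 2 * F k x" "F k x \<le> 2 * G k x"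
proof -
  define A u v where "A = a (2 * k)" and "u = poly (p (2 * k)) x" and "v = poly (p (2 * k + 1)) x"
  have A: "A > 0" "\<bar>x\<bar> \<le> A" using a_pos assms by (auto simp: A_def)
  have G: "G k x = A * (u\<^sup>2 + v\<^sup>2)" by (simp add: G_def A_def u_def v_def)
  have "\<bar>G k x - F k x\<bar> = \<bar>x\<bar> * (\<bar>u\<bar> * \<bar>v\<bar>)"
    by (simp add: G_def F_def u_def v_def abs_mult)
  also have "\<dots> \<le> \<bar>x\<bar> * ((u\<^sup>2 + v\<^sup>2) / 2)"
    using sum_squares_bound[of "\<bar>u\<bar>" "\<bar>v\<bar>"] by (intro mult_left_mono) auto
  also have "\<dots> = \<bar>x\<bar> / A * (G k x / 2)" using A by (simp add: G)
  finally show 1: "\<bar>G k x - F k x\<bar> \<le> \<bar>x\<bar> / a (2 * k) * (G k x / 2)" by (simp add: A_def)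
  have "\<bar>x\<bar> / A * (G k x / 2) \<le> 1 * (G k x / 2)"
    using A G_pos[of k x] by (intro mult_right_mono) auto
  then have "\<bar>G k x - F k x\<bar> \<le> G k x / 2" using 1[folded A_def] by linarith
  then show "G k x \<le> 2 * F k x" "F k x \<le> 2 * G k x" using G_pos[of k x] by linarith+
qed

lemma le_a_even:
  assumes "4 * C * \<bar>x\<bar> \<le> a (2 * k0)" "k0 \<le> k"
  shows "\<bar>x\<bar> \<le> a (2 * k)"
proof -
  have "1 * \<bar>x\<bar> \<le> C * \<bar>x\<bar>" using C_ge_1 by (intro mult_right_mono) auto
  then show ?thesis using assms(1) a_even_mono[OF assms(2)] by linarith
qed

lemma G_tendsto: "(\<lambda>k. G k x) \<longlonglongrightarrow> F_lim x"
proof -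
  obtain k0 where k0: "4 * C * \<bar>x\<bar> \<le> a (2 * k0)" using ex_start by blast
  have "(\<lambda>k. G k x - F k x) \<longlonglongrightarrow> 0"
  proof (rule Lim_null_comparison)
    show "\<forall>\<^sub>F k in sequentially. norm (G k x - F k x) \<le> \<bar>x\<bar> * (2 * F k0 x) * (1 / a (2 * k))"
      using eventually_ge_at_top[of k0]
    proof eventually_elim
      case (elim k)
      have "norm (G k x - F k x) \<le> \<bar>x\<bar> / a (2 * k) * (G k x / 2)"
        using F_G_le[OF le_a_even[OF k0 elim]] by simp
      also have "\<dots> \<le> \<bar>x\<bar> / a (2 * k) * (2 * F k0 x)"
        using F_G_le(2)[OF le_a_even[OF k0 elim]] F_comparable(3)[OF k0 elim] a_pos[of "2 * k"]
        by (intro mult_left_mono) auto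
      finally show ?case by simp
    qed
    show "(\<lambda>k. \<bar>x\<bar> * (2 * F k0 x) * (1 / a (2 * k))) \<longlonglongrightarrow> 0"
      by (intro tendsto_mult_right_zero tendsto_inverse_a)
  qed
  from tendsto_add[OF this F_tendsto[of x]] show ?thesis by simp
qed

lemma continuous_F: "continuous_on S (F k)"
  unfolding F_def[abs_def] by (intro continuous_intros)

lemma continuous_G: "continuous_on S (G k)"
  unfolding G_def[abs_def] by (intro continuous_intros)

lemma start_Icc:
  assumes "4 * C * \<bar>R\<bar> \<le> a (2 * k0)" "x \<in> {-R..R}"
  shows "4 * C * \<bar>x\<bar> \<le> a (2 * k0)"
proof -
  have "4 * C * \<bar>x\<bar> \<le> 4 * C * \<bar>R\<bar>" using assms(2) C_ge_1 by (intro mult_left_mono) auto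
  then show ?thesis using assms(1) by linarith
qed

text \<open>Supplies the domination on compact sets; the 4 combines the factor 2 between
  \<open>F k0\<close> and \<open>F k\<close> with the factor 2 between \<open>F k\<close> and
  \<open>G k\<close>.\<close>

lemma W_locally_bounded: "\<exists>B. \<forall>\<^sub>F k in sequentially. \<forall>x\<in>{-R..R}. W (2 * k) x \<le> B"
proof -
  obtain k0 where k0: "4 * C * \<bar>R\<bar> \<le> a (2 * k0)" using ex_start by blast
  note x0 = start_Icc[OF k0]
  have "continuous_on {-R..R} (\<lambda>x. 4 / (pi * F k0 x))"
    using F_comparable(1)[OF x0 order_refl] by (intro continuous_intros continuous_F) (auto simp: less_imp_neq[symmetric])
  then obtain B where B: "\<And>x. x \<in> {-R..R} \<Longrightarrow> 4 / (pi * F k0 x) \<le> B"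
    using continuous_Icc_bounded by blast
  have "W (2 * k) x \<le> B" if k: "k0 \<le> k" and x: "x \<in> {-R..R}" for k x
  proof -
    have F0: "F k0 x > 0" using F_comparable(1)[OF x0[OF x] order_refl] .
    have "F k0 x \<le> 4 * G k x"
      using F_comparable(2)[OF x0[OF x] k] F_G_le(3)[OF le_a_even[OF x0[OF x] k]] by linarith
    then have "1 / (pi * G k x) \<le> 4 / (pi * F k0 x)"
      using F0 G_pos[of k x] by (simp add: field_simps)
    then show ?thesis unfolding W_even using B[OF x] by linarith
  qed
  then show ?thesis unfolding eventually_sequentially by blast
qed

text \<open>The origin of \<open>C(x)\<close>. The bound must cover every \<open>k\<close>, so the
  finitely many indices below the threshold enter through their sum.\<close>

lemma G_locally_bounded: "\<exists>B. \<forall>k. \<forall>x\<in>{-R..R}. G k x \<le> B"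
proof -
  obtain k0 where k0: "4 * C * \<bar>R\<bar> \<le> a (2 * k0)" using ex_start by blast
  note x0 = start_Icc[OF k0]
  have "continuous_on {-R..R} (\<lambda>x. 4 * F k0 x + (\<Sum>k<k0. G k x))"
    by (intro continuous_intros continuous_F continuous_G)
  then obtain B where B: "\<And>x. x \<in> {-R..R} \<Longrightarrow> 4 * F k0 x + (\<Sum>k<k0. G k x) \<le> B"
    using continuous_Icc_bounded by blast
  have "G k x \<le> B" if x: "x \<in> {-R..R}" for k x
  proof (cases "k0 \<le> k")
    case True
    have "G k x \<le> 4 * F k0 x"
      using F_comparable(3)[OF x0[OF x] True] F_G_le(2)[OF le_a_even[OF x0[OF x] True]] by linarith
    moreover have "(\<Sum>k<k0. G k x) \<ge> 0" using G_pos by (intro sum_nonneg less_imp_le)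
    ultimately show ?thesis using B[OF x] by linarith
  next
    case False
    then have "G k x \<le> (\<Sum>k<k0. G k x)" using G_pos
      by (intro member_le_sum) (auto simp: less_imp_le)
    then show ?thesis using B[OF x] F_comparable(1)[OF x0[OF x] order_refl] by linarith
  qed
  then show ?thesis by blast
qed

section \<open>The weight, its orthonormal polynomials and their completeness\<close>

definition weight :: "real \<Rightarrow> real" where
  "weight x = 1 / (pi * F_lim x)"

lemma weight_pos: "weight x > 0"
  unfolding weight_def using F_lim_pos[of x] by simp

lemma weight_measurable [measurable]: "weight \<in> borel_measurable borel"
proof -
  have "F_lim \<in> borel_measurable borel"
  proof (rule borel_measurable_LIMSEQ_real)
    show "(\<lambda>k. F k x) \<longlonglongrightarrow> F_lim x" for x by (rule F_tendsto)
    show "F k \<in> borel_measurable borel" for k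
      by (intro borel_measurable_continuous_onI continuous_F)
  qed
  then show ?thesis unfolding weight_def[abs_def] by measurable
qed

lemma weight_limit:
  shows "integrable lborel (\<lambda>x. poly Q x * weight x)"
    and "\<forall>\<^sub>F k in sequentially. L (2 * k) Q = (LINT x|lborel. poly Q x * weight x)"
proof -
  have 1: "W (2 * k) \<in> borel_measurable borel" for k
    by (intro borel_measurable_continuous_onI continuous_W)
  have 2: "(\<lambda>k. W (2 * k) x) \<longlonglongrightarrow> weight x" for x
    unfolding W_even weight_def using F_lim_pos[of x] by (intro tendsto_intros G_tendsto) auto
  have 3: "\<exists>c. \<forall>\<^sub>F k in sequentially. integrable lborel (\<lambda>x. poly Q x * W (2 * k) x) \<and>
      (LINT x|lborel. poly Q x * W (2 * k) x) = c" for Q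
  proof -
    obtain c where c: "\<And>n. n \<ge> degree Q \<Longrightarrow> L n Q = c" using L_eventually_const by blast
    have "\<forall>\<^sub>F k in sequentially. integrable lborel (\<lambda>x. poly Q x * W (2 * k) x) \<and>
      (LINT x|lborel. poly Q x * W (2 * k) x) = c"
      using eventually_ge_at_top[of "degree Q"]
      by eventually_elim (use c integrable_W in \<open>auto simp: L_def\<close>)
    then show ?thesis ..
  qed
  note lim = poly_moment_limit[of "\<lambda>k. W (2 * k)" weight, OF 1 weight_measurable less_imp_le[OF W_pos] 2 W_locally_bounded 3]
  show "integrable lborel (\<lambda>x. poly Q x * weight x)" by (rule lim)
  show "\<forall>\<^sub>F k in sequentially. L (2 * k) Q = (LINT x|lborel. poly Q x * weight x)"
    unfolding L_def by (rule lim)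
qed

lemma admissible_weight_weight: "admissible_weight weight"
  unfolding admissible_weight_def
  using weight_pos weight_limit(1)[of "monom 1 k" for k] by (auto simp: poly_monom)

lemma orthonormal_polys_weight: "orthonormal_polys weight p"
  unfolding orthonormal_polys_def
proof (intro conjI allI)
  fix m n
  have "\<forall>\<^sub>F k in sequentially. L (2 * k) (p m * p n) = (if m = n then 1 else 0)"
    using eventually_ge_at_top[of "max m n"] by eventually_elim (simp add: L_orthonormal)
  with weight_limit(2)[of "p m * p n"]
  have "\<forall>\<^sub>F k::nat in sequentially. (LINT x|lborel. poly (p m * p n) x * weight x) = (if m = n then 1 else 0)"
    by eventually_elim simp
  then show "(LINT x|lborel. poly (p m) x * poly (p n) x * weight x) = (if m = n then 1 else 0)"
    by simp
qed (use degree_p lead_p_pos in auto)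

lemma is_basis_weight:
  assumes "\<not> summable (\<lambda>n. 1 / a n)"
  shows "is_basis_L2w weight p"
  unfolding is_basis_L2w_def
proof (intro allI impI)
  fix f \<epsilon> assume f: "L2w weight f" and e: "(\<epsilon>::real) > 0"
  define M where "M = density lborel weight"
  have [measurable]: "f \<in> borel_measurable borel" using f by (simp add: L2w_def)
  have int_eq: "(LINT x|M. g x) = (LINT x|lborel. g x * weight x)" if "g \<in> borel_measurable borel" for g :: "real \<Rightarrow> real"
    unfolding M_def using that weight_pos
    by (subst integral_real_density) (auto simp: less_imp_le mult.commute)
  have integrable_eq: "integrable M g \<longleftrightarrow> integrable lborel (\<lambda>x. g x * weight x)" if "g \<in> borel_measurable borel" for g :: "real \<Rightarrow> real"
    unfolding M_def using that weight_pos
    by (subst integrable_real_density) (auto simp: less_imp_le mult.commute)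
  have [measurable]: "poly Q \<in> borel_measurable borel" for Q :: "real poly"
    by (intro borel_measurable_continuous_onI continuous_intros)
  interpret jacobi_measure a M
  proof unfold_locales
    show "sets M = sets borel" by (simp add: M_def)
    show "integrable M (poly Q)" for Q by (simp add: integrable_eq weight_limit(1))
    show "(LINT x|M. poly (p i) x * poly (p j) x) = (if i = j then 1 else 0)" for i j
      using orthonormal_polys_weight unfolding orthonormal_polys_def by (simp add: int_eq)
  qed
  have "L2 f" using f unfolding L2_def L2w_def by (simp add: integrable_eq)
  then have "poly_closure f" by (rule poly_dense[OF assms])
  then obtain Q where Q: "(LINT x|M. (f x - poly Q x)\<^sup>2) < \<epsilon>"
    using e unfolding poly_closure_def by blast
  obtain c where c: "Q = (\<Sum>j\<le>degree Q. smult (c j) (p j))"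
    using poly_expansion[of p Q "degree Q"] by auto
  have "poly Q x = (\<Sum>n<Suc (degree Q). c n * poly (p n) x)" for x
    by (subst c) (simp add: poly_sum lessThan_Suc_atMost)
  then have "(LINT x|lborel. (f x - (\<Sum>n<Suc (degree Q). c n * poly (p n) x))\<^sup>2 * weight x) < \<epsilon>"
    using Q by (simp add: int_eq)
  then show "\<exists>N c. (LINT x|lborel. (f x - (\<Sum>n<N. c n * poly (p n) x))\<^sup>2 * weight x) < \<epsilon>" by blast
qed

end

section \<open>From the given sequence to the Jacobi coefficients\<close>

theorem theorem1p3:
  fixes b :: "nat \<Rightarrow> real"
  assumes "mono b \<or> antimono b"
    and "\<And>n. b n > 0"
    and "filterlim b at_top sequentially"
    and "(\<lambda>n. b (Suc n) / b n) \<longlonglongrightarrow> 1"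
    and "\<not> summable (\<lambda>n. 1 / b n)"
  shows "\<exists>w. admissible_weight w \<and> (\<exists>p. orthonormal_polys w p) \<and>
           (\<forall>p. orthonormal_polys w p \<longrightarrow>
              is_basis_L2w w p \<and>
              (\<exists>C. (\<forall>x. C x > 0) \<and> locally_bounded C \<and>
                   (\<forall>n x. (poly (p n) x)\<^sup>2 \<le> C x / b n)))"
proof -
  note b_pos = assms(2)
  \<comment> \<open>Divergence to infinity excludes the decreasing alternative.\<close>
  have "mono b"
  proof (rule ccontr)
    assume "\<not> mono b"
    then have "antimono b" using assms(1) by blast
    then have "b n \<le> b 0" for n by (simp add: antimonoD)
    moreover have "\<forall>\<^sub>F n in sequentially. b 0 + 1 \<le> b n"
      using assms(3) unfolding filterlim_at_top by blast
    then obtain n where "b 0 + 1 \<le> b n" using eventually_happens trivial_limit_sequentially by blast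
    ultimately show False by (smt (verit))
  qed
  obtain K where K: "\<And>n. norm (b (Suc n) / b n) \<le> K"
    using convergent_imp_Bseq[OF convergentI[OF assms(4)]] unfolding Bseq_def by blast
  have bK: "b (Suc n) \<le> K * b n" for n
    using K[of n] b_pos[of n] b_pos[of "Suc n"] by (simp add: pos_divide_le_eq)
  have K1: "K \<ge> 1"
  proof -
    have "1 * b 0 \<le> K * b 0" using bK[of 0] monoD[OF \<open>mono b\<close>, of 0 1] by simp
    then show ?thesis using b_pos[of 0] mult_right_le_imp_le by blast
  qed
  \<comment> \<open>The subtraction is never truncated: the second branch has \<open>n\<close>
    odd.\<close>
  define a where "a n = (if even n then b n else sqrt (b (n - 1) * b (n + 1)))" for n
  have a_even: "a (2 * k) = b (2 * k)" for k by (simp add: a_def)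
  \<comment> \<open>\<open>K\<close> bounds the ratio over one index, and consecutive even indices
    are two apart; hence the square.\<close>
  interpret paired_jacobi a "K\<^sup>2"
  proof
    show "a n > 0" for n using b_pos by (simp add: a_def)
    show "(a (2 * k + 1))\<^sup>2 = a (2 * k) * a (2 * Suc k)" for k
      using b_pos[of "2 * k"] b_pos[of "2 * Suc k"] by (simp add: a_def less_imp_le)
    show "a (2 * k) \<le> a (2 * Suc k)" for k
      unfolding a_even by (rule monoD[OF \<open>mono b\<close>]) simp
    show "a (2 * Suc k) \<le> K\<^sup>2 * a (2 * k)" for k
    proof -
      have "b (2 * Suc k) \<le> K * b (2 * k + 1)" using bK[of "2 * k + 1"] by simp
      also have "\<dots> \<le> K * (K * b (2 * k))" using bK[of "2 * k"] K1 by (intro mult_left_mono) auto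
      finally show ?thesis by (simp only: a_even power2_eq_square mult.assoc)
    qed
    show "filterlim (\<lambda>k. a (2 * k)) at_top sequentially"
      unfolding a_even by (rule filterlim_compose[OF assms(3) mult_nat_left_at_top]) simp
  qed
  have not_summable: "\<not> summable (\<lambda>n. 1 / a n)"
  proof
    assume s: "summable (\<lambda>n. 1 / a n)"
    have se: "summable (\<lambda>k. 1 / a (2 * k))"
      using summable_reindex[OF s, of "\<lambda>k. 2 * k"] by (simp add: inj_on_def comp_def less_imp_le[OF a_pos])
    have "summable (\<lambda>n. 1 / b n)"
    proof (rule summableI_nonneg_bounded)
      show "0 \<le> 1 / b n" for n using b_pos[of n] by simp
      \<comment> \<open>Monotonicity bounds each odd term of \<open>1 / b\<close> by the preceding
        even one, where \<open>a\<close> and \<open>b\<close> agree; convergence of the even part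
        would therefore force convergence of the whole series.\<close>
      have even_sum: "(\<Sum>n<2 * m. 1 / b n) \<le> (\<Sum>k<m. 2 * (1 / a (2 * k)))" for m
      proof (induction m)
        case (Suc m)
        have "1 / b (2 * m + 1) \<le> 1 / b (2 * m)"
          using monoD[OF \<open>mono b\<close>, of "2 * m" "2 * m + 1"] b_pos[of "2 * m"] by (intro divide_left_mono) (auto simp: b_pos)
        then show ?case using Suc by (simp add: a_even)
      qed simp
      show "(\<Sum>n<m. 1 / b n) \<le> (\<Sum>k. 2 * (1 / a (2 * k)))" for m
      proof -
        have "(\<Sum>n<m. 1 / b n) \<le> (\<Sum>n<2 * m. 1 / b n)"
          using b_pos by (intro sum_mono2) (auto simp: less_imp_le)
        also have "\<dots> \<le> (\<Sum>k<m. 2 * (1 / a (2 * k)))" by (rule even_sum)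
        also have "\<dots> \<le> (\<Sum>k. 2 * (1 / a (2 * k)))"
          using a_pos by (intro sum_le_suminf summable_mult se) (auto simp: less_imp_le)
        finally show ?thesis .
      qed
    qed
    then show False using assms(5) by simp
  qed
  have bG: "b n * (poly (p n) x)\<^sup>2 \<le> K * G (n div 2) x" for n x
  proof -
    define k where "k = n div 2"
    have G0: "a (2 * k) * (poly (p n) x)\<^sup>2 \<le> G k x"
      unfolding G_def k_def using a_pos[of "2 * (n div 2)"]
      by (cases "even n") (auto elim!: evenE oddE intro!: mult_left_mono)
    have "b n \<le> K * a (2 * k)"
    proof (cases "even n")
      case True
      then have n: "n = 2 * k" by (simp add: k_def)
      show ?thesis unfolding a_even n using K1 b_pos[of "2 * k"] by simp
    next
      case False
      then have n: "n = Suc (2 * k)" by (simp add: k_def)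
      show ?thesis unfolding a_even n by (rule bK)
    qed
    then have "b n * (poly (p n) x)\<^sup>2 \<le> K * a (2 * k) * (poly (p n) x)\<^sup>2" by (intro mult_right_mono) auto
    also have "\<dots> \<le> K * G k x" using G0 K1 by (simp add: mult.assoc)
    finally show ?thesis unfolding k_def .
  qed
  \<comment> \<open>The supremum is finite by the local bound on \<open>G\<close>; the added 1 makes
    \<open>Cf\<close> strictly positive.\<close>
  define Cf where "Cf x = 1 + (SUP n. b n * (poly (p n) x)\<^sup>2)" for x
  have loc: "\<exists>B. \<forall>n. \<forall>x\<in>{-R..R}. b n * (poly (p n) x)\<^sup>2 \<le> B" for R
  proof -
    obtain B where B: "\<And>k x. x \<in> {-R..R} \<Longrightarrow> G k x \<le> B" using G_locally_bounded by blast
    have "b n * (poly (p n) x)\<^sup>2 \<le> K * B" if "x \<in> {-R..R}" for n x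
      using bG[of n x] B[OF that, of "n div 2"] K1 by (meson mult_left_mono order_trans zero_le_one)
    then show ?thesis by blast
  qed
  have bdd: "bdd_above (range (\<lambda>n. b n * (poly (p n) x)\<^sup>2))" for x
    using loc[of "\<bar>x\<bar>"] by (force simp: bdd_above_def)
  have Cf_ge: "b n * (poly (p n) x)\<^sup>2 \<le> Cf x - 1" for n x
    unfolding Cf_def using cSUP_upper[OF UNIV_I bdd, of n x] by simp
  have Cf_nn: "Cf x \<ge> 1" for x
    using Cf_ge[of 0 x] b_pos[of 0] zero_le_power2[of "poly (p 0) x"]
    by (smt (verit) mult_nonneg_nonneg)
  have Cf_loc: "locally_bounded Cf"
    unfolding locally_bounded_def
  proof (intro allI impI)
    fix S :: "real set" assume "compact S"
    then have "bounded S" by (rule compact_imp_bounded)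
    then obtain R where R: "S \<subseteq> {-R..R}" unfolding bounded_iff by (auto simp: abs_le_iff subset_iff) force
    obtain B where B: "\<And>n x. x \<in> {-R..R} \<Longrightarrow> b n * (poly (p n) x)\<^sup>2 \<le> B" using loc by blast
    have "norm (Cf x) \<le> 1 + B" if "x \<in> S" for x
    proof -
      have "(SUP n. b n * (poly (p n) x)\<^sup>2) \<le> B" using B R that by (intro cSUP_least) auto
      then show ?thesis using Cf_nn[of x] by (simp add: Cf_def)
    qed
    then show "bounded (Cf ` S)" unfolding bounded_iff by blast
  qed
  have Cf: "(poly (p n) x)\<^sup>2 \<le> Cf x / b n" for n x
    using Cf_ge[of n x] b_pos[of n] by (simp add: pos_le_divide_eq mult.commute)
  show ?thesis
  proof (rule exI[of _ weight], intro conjI allI impI)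
    show "admissible_weight weight" by (rule admissible_weight_weight)
    show "\<exists>p. orthonormal_polys weight p" using orthonormal_polys_weight by blast
    fix q assume "orthonormal_polys weight q"
    then have q: "q = p"
      using orthonormal_polys_unique[OF admissible_weight_weight] orthonormal_polys_weight by blast
    show "is_basis_L2w weight q" unfolding q by (rule is_basis_weight[OF not_summable])
    show "\<exists>C. (\<forall>x. C x > 0) \<and> locally_bounded C \<and> (\<forall>n x. (poly (q n) x)\<^sup>2 \<le> C x / b n)"
      unfolding q using Cf Cf_loc less_le_trans[OF zero_less_one Cf_nn] by (intro exI[of _ Cf]) auto
  qed
qed

end
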